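(* Let $(T,\gamma)$ be a $B$-$A$ herd with pen $\widehat{T}$. Let $\gamma_A:T\to T\otimes_A\widehat{T}\otimes_S T$ and $\gamma_B:T\to T\otimes_R\widehat{T}\otimes_B T$ be the compositions of $\gamma$ with the canonical surjections. Write $T^*=\mathrm{Hom}_A(T,A)$ (right $A$-module maps) and ${}^*T=\mathrm{Hom}_B(T,B)$ (left $B$-module maps). (1) The $A$-bimodule $\mathcal{C}=\widehat{T}\otimes_S T\cong T^*\otimes_S T$ is an $A$-coring with coproduct $$\Delta_{\mathcal{C}}:\hat{x}\otimes_S x\mapsto\hat{x}\otimes_S\gamma_A(x),$$ and counit $\varepsilon_{\mathcal{C}}=\mathrm{ev}$. $T$ is a right $\mathcal{C}$-comodule with the coaction $\gamma_A$. (2) The $B$-bimodule $\mathcal{D}=T\otimes_R\widehat{T}\cong T\otimes_R{}^*T$ is a $B$-coring with coproduct $$\Delta_{\mathcal{D}}:x\otimes_R\hat{x}\mapsto\gamma_B(x)\otimes_R\hat{x},$$ and counit $\varepsilon_{\mathcal{D}}=\widehat{\mathrm{ev}}$. $T$ is a left $\mathcal{D}$-comodule with the coaction $\gamma_B$.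
   Context: All rings are associative and unital. $\alpha:R\to A$ and $\beta:S\to B$ are fixed ring homomorphisms; $A$-modules are regarded as $R$-modules via $\alpha$ and $B$-modules as $S$-modules via $\beta$. The identity map on an object $X$ is denoted $X$. Formal dual: given a $B$-$A$ bimodule $T$, an $A$-$B$ bimodule $\widehat{T}$ is a formal dual of $T$ if there exist an $A$-bimodule map $\mathrm{ev}:\widehat{T}\otimes_S T\to A$ and a $B$-bimodule map $\widehat{\mathrm{ev}}:T\otimes_R\widehat{T}\to B$ such that for all $x,y\in T$, $\hat{x},\hat{y}\in\widehat{T}$: $$\widehat{\mathrm{ev}}(x\otimes_R\hat{x})\,y=x\,\mathrm{ev}(\hat{x}\otimes_S y),\qquad \hat{x}\,\widehat{\mathrm{ev}}(x\otimes_R\hat{y})=\mathrm{ev}(\hat{x}\otimes_S x)\,\hat{y}.$$ Herd: a $B$-$A$ bimodule $T$ with a formal dual $\widehat{T}$ (called the pen) is a bimodule herd, or $B$-$A$ herd, $(T,\gamma)$ if there is an $S$-$R$ bimodule map (the shepherd) $\gamma:T\to T\otimes_R\widehat{T}\otimes_S T$, written $\gamma(x)=x^{\langle1\rangle}\otimes_R x^{\langle2\rangle}\otimes_S x^{\langle3\rangle}$ (summation implicit), such that for all $x\in T$: $\widehat{\mathrm{ev}}(x^{\langle1\rangle}\otimes_R x^{\langle2\rangle})\otimes_S x^{\langle3\rangle}=1_B\otimes_S x$ in $B\otimes_S T$; $x^{\langle1\rangle}\otimes_R\mathrm{ev}(x^{\langle2\rangle}\otimes_S x^{\langle3\rangle})=x\otimes_R1_A$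 in $T\otimes_R A$; and $(\gamma\otimes_R\widehat{T}\otimes_S T)\circ\gamma=(T\otimes_R\widehat{T}\otimes_S\gamma)\circ\gamma$. An $A$-coring is an $A$-bimodule $\mathcal{C}$ with $A$-bimodule maps $\Delta_{\mathcal{C}}:\mathcal{C}\to\mathcal{C}\otimes_A\mathcal{C}$ and $\varepsilon_{\mathcal{C}}:\mathcal{C}\to A$ that are coassociative and counital; comodules are defined in the usual way. *)

theory Defs
  imports "HOL-Algebra.RingHom" "HOL-Algebra.Free_Abelian_Groups"
begin

section \<open>Modules and bimodules over non-commutative rings\<close>

text \<open>
  As for \<open>module\<close> in HOL-Algebra, the underlying additive group is stored in a ring record whose
  fields \<open>mult\<close> and \<open>one\<close> are irrelevant.  The same record serves for left modules, right modules
  and bimodules; the locales below select which of the two actions matter.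
\<close>

record ('l, 'r, 'm) bimod = "'m ring" +
  lact :: "'l \<Rightarrow> 'm \<Rightarrow> 'm" (infixr \<open>\<triangleright>\<index>\<close> 70)
  ract :: "'m \<Rightarrow> 'r \<Rightarrow> 'm" (infixl \<open>\<triangleleft>\<index>\<close> 70)

locale left_module = L?: ring L + M?: abelian_group M
  for L :: "('l, 'x) ring_scheme" (structure) and M :: "('l, 'r, 'm) bimod" (structure) +
  assumes lact_closed: "\<lbrakk>a \<in> carrier L; m \<in> carrier M\<rbrakk> \<Longrightarrow> a \<triangleright>\<^bsub>M\<^esub> m \<in> carrier M"
    and lact_add: "\<lbrakk>a \<in> carrier L; m \<in> carrier M; n \<in> carrier M\<rbrakk>
      \<Longrightarrow> a \<triangleright>\<^bsub>M\<^esub> (m \<oplus>\<^bsub>M\<^esub> n) = (a \<triangleright>\<^bsub>M\<^esub> m) \<oplus>\<^bsub>M\<^esub> (a \<triangleright>\<^bsub>M\<^esub> n)"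
    and add_lact: "\<lbrakk>a \<in> carrier L; b \<in> carrier L; m \<in> carrier M\<rbrakk>
      \<Longrightarrow> (a \<oplus>\<^bsub>L\<^esub> b) \<triangleright>\<^bsub>M\<^esub> m = (a \<triangleright>\<^bsub>M\<^esub> m) \<oplus>\<^bsub>M\<^esub> (b \<triangleright>\<^bsub>M\<^esub> m)"
    and mult_lact: "\<lbrakk>a \<in> carrier L; b \<in> carrier L; m \<in> carrier M\<rbrakk>
      \<Longrightarrow> (a \<otimes>\<^bsub>L\<^esub> b) \<triangleright>\<^bsub>M\<^esub> m = a \<triangleright>\<^bsub>M\<^esub> (b \<triangleright>\<^bsub>M\<^esub> m)"
    and one_lact: "m \<in> carrier M \<Longrightarrow> \<one>\<^bsub>L\<^esub> \<triangleright>\<^bsub>M\<^esub> m = m"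

locale right_module = Q?: ring Q + M?: abelian_group M
  for Q :: "('r, 'x) ring_scheme" (structure) and M :: "('l, 'r, 'm) bimod" (structure) +
  assumes ract_closed: "\<lbrakk>m \<in> carrier M; a \<in> carrier Q\<rbrakk> \<Longrightarrow> m \<triangleleft>\<^bsub>M\<^esub> a \<in> carrier M"
    and ract_add: "\<lbrakk>m \<in> carrier M; n \<in> carrier M; a \<in> carrier Q\<rbrakk>
      \<Longrightarrow> (m \<oplus>\<^bsub>M\<^esub> n) \<triangleleft>\<^bsub>M\<^esub> a = (m \<triangleleft>\<^bsub>M\<^esub> a) \<oplus>\<^bsub>M\<^esub> (n \<triangleleft>\<^bsub>M\<^esub> a)"
    and add_ract: "\<lbrakk>m \<in> carrier M; a \<in> carrier Q; b \<in> carrier Q\<rbrakk>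
      \<Longrightarrow> m \<triangleleft>\<^bsub>M\<^esub> (a \<oplus>\<^bsub>Q\<^esub> b) = (m \<triangleleft>\<^bsub>M\<^esub> a) \<oplus>\<^bsub>M\<^esub> (m \<triangleleft>\<^bsub>M\<^esub> b)"
    and mult_ract: "\<lbrakk>m \<in> carrier M; a \<in> carrier Q; b \<in> carrier Q\<rbrakk>
      \<Longrightarrow> m \<triangleleft>\<^bsub>M\<^esub> (a \<otimes>\<^bsub>Q\<^esub> b) = (m \<triangleleft>\<^bsub>M\<^esub> a) \<triangleleft>\<^bsub>M\<^esub> b"
    and one_ract: "m \<in> carrier M \<Longrightarrow> m \<triangleleft>\<^bsub>M\<^esub> \<one>\<^bsub>Q\<^esub> = m"

locale bimodule = left_module L M + right_module Q M
  for L :: "('l, 'x) ring_scheme" and Q :: "('r, 'y) ring_scheme" and M :: "('l, 'r, 'm) bimod" +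
  assumes lact_ract: "\<lbrakk>a \<in> carrier L; m \<in> carrier M; b \<in> carrier Q\<rbrakk>
      \<Longrightarrow> (a \<triangleright>\<^bsub>M\<^esub> m) \<triangleleft>\<^bsub>M\<^esub> b = a \<triangleright>\<^bsub>M\<^esub> (m \<triangleleft>\<^bsub>M\<^esub> b)"

definition add_hom :: "('l, 'r, 'm) bimod \<Rightarrow> ('k, 'q, 'n) bimod \<Rightarrow> ('m \<Rightarrow> 'n) set" where
  "add_hom M N = {f \<in> carrier M \<rightarrow> carrier N.
     \<forall>x\<in>carrier M. \<forall>y\<in>carrier M. f (x \<oplus>\<^bsub>M\<^esub> y) = f x \<oplus>\<^bsub>N\<^esub> f y}"

definition left_hom ::
  "('l, 'x) ring_scheme \<Rightarrow> ('l, 'r, 'm) bimod \<Rightarrow> ('l, 'q, 'n) bimod \<Rightarrow> ('m \<Rightarrow> 'n) set" where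
  "left_hom L M N = {f \<in> add_hom M N.
     \<forall>a\<in>carrier L. \<forall>x\<in>carrier M. f (a \<triangleright>\<^bsub>M\<^esub> x) = a \<triangleright>\<^bsub>N\<^esub> f x}"

definition right_hom ::
  "('r, 'x) ring_scheme \<Rightarrow> ('l, 'r, 'm) bimod \<Rightarrow> ('k, 'r, 'n) bimod \<Rightarrow> ('m \<Rightarrow> 'n) set" where
  "right_hom Q M N = {f \<in> add_hom M N.
     \<forall>x\<in>carrier M. \<forall>a\<in>carrier Q. f (x \<triangleleft>\<^bsub>M\<^esub> a) = f x \<triangleleft>\<^bsub>N\<^esub> a}"

definition bimod_hom ::
  "('l, 'x) ring_scheme \<Rightarrow> ('r, 'y) ring_scheme \<Rightarrow> ('l, 'r, 'm) bimod \<Rightarrow> ('l, 'r, 'n) bimod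
     \<Rightarrow> ('m \<Rightarrow> 'n) set" where
  "bimod_hom L Q M N = left_hom L M N \<inter> right_hom Q M N"

definition bimod_isomorphic ::
  "('l, 'x) ring_scheme \<Rightarrow> ('r, 'y) ring_scheme \<Rightarrow> ('l, 'r, 'm) bimod \<Rightarrow> ('l, 'r, 'n) bimod
     \<Rightarrow> bool" where
  "bimod_isomorphic L Q M N \<longleftrightarrow>
     (\<exists>h \<in> bimod_hom L Q M N. bij_betw h (carrier M) (carrier N))"

definition regular :: "('a, 'x) ring_scheme \<Rightarrow> ('a, 'a, 'a) bimod" where
  "regular A = \<lparr>carrier = carrier A, monoid.mult = monoid.mult A, one = one A,
     ring.zero = ring.zero A, add = add A, lact = monoid.mult A, ract = monoid.mult A\<rparr>"

definition restrict_scalars ::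
  "('s \<Rightarrow> 'l) \<Rightarrow> ('q \<Rightarrow> 'r) \<Rightarrow> ('l, 'r, 'm) bimod \<Rightarrow> ('s, 'q, 'm) bimod" where
  "restrict_scalars \<phi> \<psi> M = \<lparr>carrier = carrier M, monoid.mult = monoid.mult M, one = one M,
     ring.zero = ring.zero M, add = add M,
     lact = (\<lambda>s x. \<phi> s \<triangleright>\<^bsub>M\<^esub> x), ract = (\<lambda>x q. x \<triangleleft>\<^bsub>M\<^esub> \<psi> q)\<rparr>"

text \<open>
  The two duals of a \<open>B\<close>-\<open>A\<close> bimodule \<open>T\<close>, both \<open>A\<close>-\<open>B\<close> bimodules:
  \<open>right_dual A T\<close> is \<open>Hom\<^sub>A(T, A)\<close> (right \<open>A\<close>-linear maps) with \<open>(a f b)(t) = a f(b t)\<close>, and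
  \<open>left_dual B T\<close> is \<open>Hom\<^sub>B(T, B)\<close> (left \<open>B\<close>-linear maps) with \<open>(a f b)(t) = f(t a) b\<close>.
  Maps are taken extensional so that equality in the carrier is equality of maps on \<open>T\<close>.
\<close>

definition right_dual ::
  "('a, 'x) ring_scheme \<Rightarrow> ('b, 'a, 't) bimod \<Rightarrow> ('a, 'b, 't \<Rightarrow> 'a) bimod" where
  "right_dual A T = \<lparr>carrier = right_hom A T (regular A) \<inter> extensional (carrier T),
     monoid.mult = undefined, one = undefined,
     ring.zero = (\<lambda>t\<in>carrier T. \<zero>\<^bsub>A\<^esub>),
     add = (\<lambda>f g. \<lambda>t\<in>carrier T. f t \<oplus>\<^bsub>A\<^esub> g t),
     lact = (\<lambda>a f. \<lambda>t\<in>carrier T. a \<otimes>\<^bsub>A\<^esub> f t),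
     ract = (\<lambda>f b. \<lambda>t\<in>carrier T. f (b \<triangleright>\<^bsub>T\<^esub> t))\<rparr>"

definition left_dual ::
  "('b, 'x) ring_scheme \<Rightarrow> ('b, 'a, 't) bimod \<Rightarrow> ('a, 'b, 't \<Rightarrow> 'b) bimod" where
  "left_dual B T = \<lparr>carrier = left_hom B T (regular B) \<inter> extensional (carrier T),
     monoid.mult = undefined, one = undefined,
     ring.zero = (\<lambda>t\<in>carrier T. \<zero>\<^bsub>B\<^esub>),
     add = (\<lambda>f g. \<lambda>t\<in>carrier T. f t \<oplus>\<^bsub>B\<^esub> g t),
     lact = (\<lambda>a f. \<lambda>t\<in>carrier T. f (t \<triangleleft>\<^bsub>T\<^esub> a)),
     ract = (\<lambda>f b. \<lambda>t\<in>carrier T. f t \<otimes>\<^bsub>B\<^esub> b)\<rparr>"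


section \<open>Tensor products\<close>

text \<open>
  Throughout, \<open>\<phi> : K \<rightarrow> L\<close> is a ring homomorphism, \<open>M\<close> a right and \<open>N\<close> a left \<open>L\<close>-module, and
  \<open>tensor K \<phi> M N\<close> is \<open>M \<otimes>\<^sub>K N\<close>, where \<open>M\<close> and \<open>N\<close> are regarded as \<open>K\<close>-modules via \<open>\<phi>\<close>.
  The ordinary tensor product \<open>M \<otimes>\<^sub>L N\<close> is \<open>tensor L id M N\<close>.
  It is the quotient of the free abelian group on \<open>M \<times> N\<close> by the usual relations.
\<close>

type_synonym ('m, 'n) tens = "('m \<times> 'n \<Rightarrow>\<^sub>0 int) set"

definition tensor_free :: "('l, 'a, 'm) bimod \<Rightarrow> ('a, 'r, 'n) bimod \<Rightarrow> ('m \<times> 'n \<Rightarrow>\<^sub>0 int) monoid" where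
  "tensor_free M N = free_Abelian_group (carrier M \<times> carrier N)"

definition tensor_relations ::
  "('k, 'x) ring_scheme \<Rightarrow> ('k \<Rightarrow> 'a) \<Rightarrow> ('l, 'a, 'm) bimod \<Rightarrow> ('a, 'r, 'n) bimod
     \<Rightarrow> ('m \<times> 'n \<Rightarrow>\<^sub>0 int) set" where
  "tensor_relations K \<phi> M N =
     {frag_of (x \<oplus>\<^bsub>M\<^esub> x', y) - frag_of (x, y) - frag_of (x', y) | x x' y.
        x \<in> carrier M \<and> x' \<in> carrier M \<and> y \<in> carrier N} \<union>
     {frag_of (x, y \<oplus>\<^bsub>N\<^esub> y') - frag_of (x, y) - frag_of (x, y') | x y y'.
        x \<in> carrier M \<and> y \<in> carrier N \<and> y' \<in> carrier N} \<union>
     {frag_of (x \<triangleleft>\<^bsub>M\<^esub> \<phi> k, y) - frag_of (x, \<phi> k \<triangleright>\<^bsub>N\<^esub> y) | x k y.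
        x \<in> carrier M \<and> k \<in> carrier K \<and> y \<in> carrier N}"

definition tensor_kernel ::
  "('k, 'x) ring_scheme \<Rightarrow> ('k \<Rightarrow> 'a) \<Rightarrow> ('l, 'a, 'm) bimod \<Rightarrow> ('a, 'r, 'n) bimod
     \<Rightarrow> ('m \<times> 'n \<Rightarrow>\<^sub>0 int) set" where
  "tensor_kernel K \<phi> M N = generate (tensor_free M N) (tensor_relations K \<phi> M N)"

definition tensor_group ::
  "('k, 'x) ring_scheme \<Rightarrow> ('k \<Rightarrow> 'a) \<Rightarrow> ('l, 'a, 'm) bimod \<Rightarrow> ('a, 'r, 'n) bimod
     \<Rightarrow> ('m, 'n) tens ring" where
  "tensor_group K \<phi> M N = (let Q = tensor_free M N Mod tensor_kernel K \<phi> M N in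
     \<lparr>carrier = carrier Q, monoid.mult = undefined, one = undefined,
      ring.zero = one Q, add = monoid.mult Q\<rparr>)"

definition pure_tensor ::
  "('k, 'x) ring_scheme \<Rightarrow> ('k \<Rightarrow> 'a) \<Rightarrow> ('l, 'a, 'm) bimod \<Rightarrow> ('a, 'r, 'n) bimod
     \<Rightarrow> 'm \<Rightarrow> 'n \<Rightarrow> ('m, 'n) tens" where
  "pure_tensor K \<phi> M N x y = tensor_kernel K \<phi> M N #>\<^bsub>tensor_free M N\<^esub> frag_of (x, y)"

text \<open>
  \<open>tensor_lift G f\<close> is the additive map sending \<open>x \<otimes> y\<close> to \<open>f x y\<close>.  It evaluates the biadditive
  extension of \<open>f\<close> at a representative; the choice is immaterial whenever \<open>f\<close> is a
  balanced biadditive map into the abelian group \<open>G\<close>.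
\<close>

definition tensor_lift ::
  "('g, 'x) ring_scheme \<Rightarrow> ('m \<Rightarrow> 'n \<Rightarrow> 'g) \<Rightarrow> ('m, 'n) tens \<Rightarrow> 'g" where
  "tensor_lift G f X = (let c = (SOME c. c \<in> X) in
     \<Oplus>\<^bsub>G\<^esub> z \<in> Poly_Mapping.keys c. [Poly_Mapping.lookup c z] \<cdot>\<^bsub>G\<^esub> f (fst z) (snd z))"

definition tensor ::
  "('k, 'x) ring_scheme \<Rightarrow> ('k \<Rightarrow> 'a) \<Rightarrow> ('l, 'a, 'm) bimod \<Rightarrow> ('a, 'r, 'n) bimod
     \<Rightarrow> ('l, 'r, ('m, 'n) tens) bimod" where
  "tensor K \<phi> M N = (let G = tensor_group K \<phi> M N in
     \<lparr>carrier = carrier G, monoid.mult = monoid.mult G, one = one G,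
      ring.zero = ring.zero G, add = add G,
      lact = (\<lambda>a. tensor_lift G (\<lambda>x y. pure_tensor K \<phi> M N (a \<triangleright>\<^bsub>M\<^esub> x) y)),
      ract = (\<lambda>X b. tensor_lift G (\<lambda>x y. pure_tensor K \<phi> M N x (y \<triangleleft>\<^bsub>N\<^esub> b)) X)\<rparr>)"

text \<open>
  \<open>tensor_map K \<phi> M N f g\<close> is \<open>x \<otimes> y \<mapsto> f x \<otimes> g y\<close>.  The parameters \<open>K \<phi> M N\<close> describe the
  \<^emph>\<open>target\<close>; the source may be a tensor product over a different ring, so that the canonical
  surjection \<open>M \<otimes>\<^sub>K N \<rightarrow> M \<otimes>\<^sub>L N\<close> is \<open>tensor_map L id M N id id\<close>.
\<close>

definition tensor_map ::
  "('k, 'x) ring_scheme \<Rightarrow> ('k \<Rightarrow> 'a) \<Rightarrow> ('l, 'a, 'm) bimod \<Rightarrow> ('a, 'r, 'n) bimod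
     \<Rightarrow> ('p \<Rightarrow> 'm) \<Rightarrow> ('q \<Rightarrow> 'n) \<Rightarrow> ('p, 'q) tens \<Rightarrow> ('m, 'n) tens" where
  "tensor_map K \<phi> M N f g =
     tensor_lift (tensor K \<phi> M N) (\<lambda>x y. pure_tensor K \<phi> M N (f x) (g y))"

text \<open>
  The associativity isomorphism
  \<open>(M \<otimes>\<^sub>K N) \<otimes>\<^sub>J P \<rightarrow> M \<otimes>\<^sub>K (N \<otimes>\<^sub>J P)\<close>, \<open>(x \<otimes> y) \<otimes> z \<mapsto> x \<otimes> (y \<otimes> z)\<close>, and its inverse.
\<close>

definition tensor_assoc ::
  "('k, 'x) ring_scheme \<Rightarrow> ('k \<Rightarrow> 'a) \<Rightarrow> ('j, 'y) ring_scheme \<Rightarrow> ('j \<Rightarrow> 'b)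
     \<Rightarrow> ('l, 'a, 'm) bimod \<Rightarrow> ('a, 'b, 'n) bimod \<Rightarrow> ('b, 'r, 'p) bimod
     \<Rightarrow> (('m, 'n) tens, 'p) tens \<Rightarrow> ('m, ('n, 'p) tens) tens" where
  "tensor_assoc K \<phi> J \<psi> M N P = (let NP = tensor J \<psi> N P; G = tensor K \<phi> M NP in
     tensor_lift G (\<lambda>X z. tensor_lift G
       (\<lambda>x y. pure_tensor K \<phi> M NP x (pure_tensor J \<psi> N P y z)) X))"

definition tensor_assoc_inv ::
  "('k, 'x) ring_scheme \<Rightarrow> ('k \<Rightarrow> 'a) \<Rightarrow> ('j, 'y) ring_scheme \<Rightarrow> ('j \<Rightarrow> 'b)
     \<Rightarrow> ('l, 'a, 'm) bimod \<Rightarrow> ('a, 'b, 'n) bimod \<Rightarrow> ('b, 'r, 'p) bimod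
     \<Rightarrow> ('m, ('n, 'p) tens) tens \<Rightarrow> (('m, 'n) tens, 'p) tens" where
  "tensor_assoc_inv K \<phi> J \<psi> M N P = (let MN = tensor K \<phi> M N; G = tensor J \<psi> MN P in
     tensor_lift G (\<lambda>x Y. tensor_lift G
       (\<lambda>y z. pure_tensor J \<psi> MN P (pure_tensor K \<phi> M N x y) z) Y))"


section \<open>Corings and comodules\<close>

locale coring = bimodule A A C
  for A :: "('a, 'x) ring_scheme" and C :: "('a, 'a, 'c) bimod" +
  fixes \<Delta> :: "'c \<Rightarrow> ('c, 'c) tens" and \<epsilon> :: "'c \<Rightarrow> 'a"
  assumes coproduct_hom: "\<Delta> \<in> bimod_hom A A C (tensor A id C C)"
    and counit_hom: "\<epsilon> \<in> bimod_hom A A C (regular A)"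
    and coassoc: "c \<in> carrier C \<Longrightarrow>
      tensor_assoc A id A id C C C (tensor_map A id (tensor A id C C) C \<Delta> id (\<Delta> c))
        = tensor_map A id C (tensor A id C C) id \<Delta> (\<Delta> c)"
    and counit_left: "c \<in> carrier C \<Longrightarrow> tensor_lift C (\<lambda>x y. \<epsilon> x \<triangleright>\<^bsub>C\<^esub> y) (\<Delta> c) = c"
    and counit_right: "c \<in> carrier C \<Longrightarrow> tensor_lift C (\<lambda>x y. x \<triangleleft>\<^bsub>C\<^esub> \<epsilon> y) (\<Delta> c) = c"

locale right_comodule = coring A C \<Delta> \<epsilon> + Mod: right_module A M
  for A :: "('a, 'x) ring_scheme" and C :: "('a, 'a, 'c) bimod" and \<Delta> \<epsilon>
    and M :: "('l, 'a, 'm) bimod" +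
  fixes \<rho> :: "'m \<Rightarrow> ('m, 'c) tens"
  assumes coaction_hom: "\<rho> \<in> right_hom A M (tensor A id M C)"
    and coaction_coassoc: "m \<in> carrier M \<Longrightarrow>
      tensor_assoc A id A id M C C (tensor_map A id (tensor A id M C) C \<rho> id (\<rho> m))
        = tensor_map A id M (tensor A id C C) id \<Delta> (\<rho> m)"
    and coaction_counit: "m \<in> carrier M \<Longrightarrow> tensor_lift M (\<lambda>x c. x \<triangleleft>\<^bsub>M\<^esub> \<epsilon> c) (\<rho> m) = m"

locale left_comodule = coring A C \<Delta> \<epsilon> + Mod: left_module A M
  for A :: "('a, 'x) ring_scheme" and C :: "('a, 'a, 'c) bimod" and \<Delta> \<epsilon>
    and M :: "('a, 'r, 'm) bimod" +
  fixes \<rho> :: "'m \<Rightarrow> ('c, 'm) tens"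
  assumes coaction_hom: "\<rho> \<in> left_hom A M (tensor A id C M)"
    and coaction_coassoc: "m \<in> carrier M \<Longrightarrow>
      tensor_assoc A id A id C C M (tensor_map A id (tensor A id C C) M \<Delta> id (\<rho> m))
        = tensor_map A id C (tensor A id C M) id \<rho> (\<rho> m)"
    and coaction_counit: "m \<in> carrier M \<Longrightarrow> tensor_lift M (\<lambda>c x. \<epsilon> c \<triangleright>\<^bsub>M\<^esub> x) (\<rho> m) = m"


section \<open>Formal duals and bimodule herds\<close>

text \<open>
  \<open>That\<close> is the formal dual (pen) of \<open>T\<close>, and \<open>evh\<close> is the map \<open>T \<otimes>\<^sub>R That \<rightarrow> B\<close>.
\<close>

locale formal_dual =
  alpha: ring_hom_ring R A \<alpha> + beta: ring_hom_ring S B \<beta> +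
  T: bimodule B A T + That: bimodule A B That
  for R :: "('r, 'x) ring_scheme" and S :: "('s, 'y) ring_scheme"
    and A :: "('a, 'z) ring_scheme" and B :: "('b, 'w) ring_scheme"
    and \<alpha> :: "'r \<Rightarrow> 'a" and \<beta> :: "'s \<Rightarrow> 'b"
    and T :: "('b, 'a, 't) bimod" and That :: "('a, 'b, 'u) bimod" +
  fixes ev :: "('u, 't) tens \<Rightarrow> 'a" and evh :: "('t, 'u) tens \<Rightarrow> 'b"
  assumes ev_hom: "ev \<in> bimod_hom A A (tensor S \<beta> That T) (regular A)"
    and evh_hom: "evh \<in> bimod_hom B B (tensor R \<alpha> T That) (regular B)"
    and evh_ev: "\<lbrakk>x \<in> carrier T; y \<in> carrier T; u \<in> carrier That\<rbrakk> \<Longrightarrow>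
      evh (pure_tensor R \<alpha> T That x u) \<triangleright>\<^bsub>T\<^esub> y = x \<triangleleft>\<^bsub>T\<^esub> ev (pure_tensor S \<beta> That T u y)"
    and ev_evh: "\<lbrakk>x \<in> carrier T; u \<in> carrier That; v \<in> carrier That\<rbrakk> \<Longrightarrow>
      u \<triangleleft>\<^bsub>That\<^esub> evh (pure_tensor R \<alpha> T That x v)
        = ev (pure_tensor S \<beta> That T u x) \<triangleright>\<^bsub>That\<^esub> v"

text \<open>
  The codomain of the shepherd is bracketed as \<open>T \<otimes>\<^sub>R (That \<otimes>\<^sub>S T)\<close>.
  In the coassociativity axiom both sides are compared in
  \<open>T \<otimes>\<^sub>R (That \<otimes>\<^sub>S (T \<otimes>\<^sub>R (That \<otimes>\<^sub>S T)))\<close>.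
\<close>

locale bimodule_herd = formal_dual R S A B \<alpha> \<beta> T That ev evh
  for R :: "('r, 'x) ring_scheme" and S :: "('s, 'y) ring_scheme"
    and A :: "('a, 'z) ring_scheme" and B :: "('b, 'w) ring_scheme"
    and \<alpha> :: "'r \<Rightarrow> 'a" and \<beta> :: "'s \<Rightarrow> 'b"
    and T :: "('b, 'a, 't) bimod" and That :: "('a, 'b, 'u) bimod"
    and ev :: "('u, 't) tens \<Rightarrow> 'a" and evh :: "('t, 'u) tens \<Rightarrow> 'b" +
  fixes \<gamma> :: "'t \<Rightarrow> ('t, ('u, 't) tens) tens"
  assumes shepherd_hom:
    "\<gamma> \<in> bimod_hom S R (restrict_scalars \<beta> \<alpha> T)
       (restrict_scalars \<beta> \<alpha> (tensor R \<alpha> T (tensor S \<beta> That T)))"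
    and shepherd_evh: "x \<in> carrier T \<Longrightarrow>
      tensor_map S \<beta> (regular B) T evh id (tensor_assoc_inv R \<alpha> S \<beta> T That T (\<gamma> x))
        = pure_tensor S \<beta> (regular B) T \<one>\<^bsub>B\<^esub> x"
    and shepherd_ev: "x \<in> carrier T \<Longrightarrow>
      tensor_map R \<alpha> T (regular A) id ev (\<gamma> x) = pure_tensor R \<alpha> T (regular A) x \<one>\<^bsub>A\<^esub>"
    and shepherd_coassoc: "x \<in> carrier T \<Longrightarrow>
      (let C = tensor S \<beta> That T; TC = tensor R \<alpha> T C; ThTC = tensor S \<beta> That TC in
        tensor_map R \<alpha> T ThTC id (tensor_assoc S \<beta> R \<alpha> That T C)
          (tensor_assoc R \<alpha> R \<alpha> T C C
            (tensor_map R \<alpha> TC C \<gamma> id (\<gamma> x)))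
        = tensor_map R \<alpha> T ThTC id (tensor_map S \<beta> That TC id \<gamma>) (\<gamma> x))"

text \<open>
  The composites \<open>\<gamma>\<^sub>A : T \<rightarrow> T \<otimes>\<^sub>A (That \<otimes>\<^sub>S T)\<close> and \<open>\<gamma>\<^sub>B : T \<rightarrow> (T \<otimes>\<^sub>R That) \<otimes>\<^sub>B T\<close> of the shepherd
  with the canonical surjections.
\<close>

definition shepherd_A ::
  "('s, 'y) ring_scheme \<Rightarrow> ('a, 'z) ring_scheme \<Rightarrow> ('s \<Rightarrow> 'b)
     \<Rightarrow> ('b, 'a, 't) bimod \<Rightarrow> ('a, 'b, 'u) bimod \<Rightarrow> ('t \<Rightarrow> ('t, ('u, 't) tens) tens)
     \<Rightarrow> 't \<Rightarrow> ('t, ('u, 't) tens) tens" where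
  "shepherd_A S A \<beta> T That \<gamma> x = tensor_map A id T (tensor S \<beta> That T) id id (\<gamma> x)"

definition shepherd_B ::
  "('r, 'x) ring_scheme \<Rightarrow> ('s, 'y) ring_scheme \<Rightarrow> ('b, 'w) ring_scheme
     \<Rightarrow> ('r \<Rightarrow> 'a) \<Rightarrow> ('s \<Rightarrow> 'b)
     \<Rightarrow> ('b, 'a, 't) bimod \<Rightarrow> ('a, 'b, 'u) bimod \<Rightarrow> ('t \<Rightarrow> ('t, ('u, 't) tens) tens)
     \<Rightarrow> 't \<Rightarrow> (('t, 'u) tens, 't) tens" where
  "shepherd_B R S B \<alpha> \<beta> T That \<gamma> x =
     tensor_map B id (tensor R \<alpha> T That) T id id (tensor_assoc_inv R \<alpha> S \<beta> T That T (\<gamma> x))"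

end

theory Submission
  imports Defs
begin

text \<open>
  Write \<open>\<gamma>(x) = x\<^sub>1 \<otimes> x\<^sub>2 \<otimes> x\<^sub>3\<close>.  Everything rests on two consequences of the normalisation of
  the shepherd.  First, \<open>ev(u \<otimes> y\<^sub>1) y\<^sub>2 \<otimes> y\<^sub>3 = u evh(y\<^sub>1 \<otimes> y\<^sub>2) \<otimes> y\<^sub>3 = u \<otimes> y\<close> in \<open>That \<otimes>\<^sub>S T\<close>; this
  is the left counit law, and it shows that \<open>f \<otimes> x \<mapsto> f(x\<^sub>1) x\<^sub>2 \<otimes> x\<^sub>3\<close> inverts \<open>u \<otimes> x \<mapsto> ev(u \<otimes> -) \<otimes> x\<close>.
  Secondly, \<open>\<gamma>\<^sub>A\<close> is right \<open>A\<close>-linear although \<open>\<gamma>\<close> is only \<open>R\<close>-linear: the map \<open>b \<otimes> y \<mapsto> b \<gamma>\<^sub>A(y)\<close> on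
  \<open>B \<otimes>\<^sub>S T\<close> carries \<open>evh(x \<otimes> u) \<otimes> y\<close> to \<open>x \<otimes>\<^sub>A u \<otimes> y\<close>.  Since \<open>evh(x\<^sub>1 \<otimes> x\<^sub>2) \<otimes> x\<^sub>3 a = 1 \<otimes> x a\<close>, it
  carries \<open>1 \<otimes> x a\<close> to \<open>\<gamma>\<^sub>A(x) a\<close>, but its value there is \<open>\<gamma>\<^sub>A(x a)\<close>.
  The map \<open>x \<mapsto> u \<otimes> x\<close> intertwines \<open>\<gamma>\<^sub>A\<close> with the coproduct, so coassociativity of the coring follows
  from that of the comodule \<open>T\<close>, which is the image of the herd axiom.  The statements over \<open>B\<close> are
  the mirror images.
\<close>

section \<open>Tensor products over non-commutative rings\<close>

lemma keys_add_subset: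
  "\<lbrakk>Poly_Mapping.keys a \<subseteq> S; Poly_Mapping.keys b \<subseteq> S\<rbrakk> \<Longrightarrow> Poly_Mapping.keys (a + b) \<subseteq> S"
  using keys_add[of a b] by blast

lemma keys_diff_subset:
  "\<lbrakk>Poly_Mapping.keys a \<subseteq> S; Poly_Mapping.keys b \<subseteq> S\<rbrakk> \<Longrightarrow> Poly_Mapping.keys (a - b) \<subseteq> S"
  using keys_diff[of a b] by blast

text \<open>A point outside the support of a formal sum has coefficient zero and contributes a zero
  multiple. Hence the sums for \<open>c\<close>, \<open>d\<close> and \<open>c + d\<close> may all
  be taken over the union of the two supports, where additivity is checked term by term.\<close>

lemma (in abelian_group) frag_extension_hom:
  assumes F: "\<And>z. z \<in> S \<Longrightarrow> F z \<in> carrier G"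
  shows "(\<lambda>c. \<Oplus>\<^bsub>G\<^esub>z\<in>Poly_Mapping.keys c. [Poly_Mapping.lookup c z] \<cdot>\<^bsub>G\<^esub> F z)
    \<in> hom (free_Abelian_group S) (add_monoid G)" (is "?h \<in> _")
proof (rule homI)
  fix c assume c: "c \<in> carrier (free_Abelian_group S)"
  have "?h c \<in> carrier G"
    using c F by (intro finsum_closed) (auto intro: add.int_pow_closed)
  then show "?h c \<in> carrier (add_monoid G)"
    by simp
next
  fix c d assume cd: "c \<in> carrier (free_Abelian_group S)" "d \<in> carrier (free_Abelian_group S)"
  let ?U = "Poly_Mapping.keys c \<union> Poly_Mapping.keys d"
  have fin: "finite ?U" by simp
  have US: "?U \<subseteq> S" using cd by auto
  have pow: "[k] \<cdot>\<^bsub>G\<^esub> F z \<in> carrier G" if "z \<in> S" for z and k :: int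
    using F that by (auto intro: add.int_pow_closed)
  have ext: "?h e = (\<Oplus>\<^bsub>G\<^esub>z\<in>?U. [Poly_Mapping.lookup e z] \<cdot>\<^bsub>G\<^esub> F z)"
    if "Poly_Mapping.keys e \<subseteq> ?U" for e
  proof (rule add.finprod_mono_neutral_cong_left[OF fin that])
    show "[Poly_Mapping.lookup e i] \<cdot>\<^bsub>G\<^esub> F i = \<zero>\<^bsub>G\<^esub>" if "i \<in> ?U - Poly_Mapping.keys e" for i
      using that by (simp add: in_keys_iff add_pow_def int_pow_def nat_pow_def)
  qed (use pow US in auto)
  have "?h (c + d) = (\<Oplus>\<^bsub>G\<^esub>z\<in>?U. [Poly_Mapping.lookup (c + d) z] \<cdot>\<^bsub>G\<^esub> F z)"
    by (rule ext) (rule keys_add)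
  also have "\<dots> = (\<Oplus>\<^bsub>G\<^esub>z\<in>?U. [Poly_Mapping.lookup c z] \<cdot>\<^bsub>G\<^esub> F z \<oplus>\<^bsub>G\<^esub> [Poly_Mapping.lookup d z] \<cdot>\<^bsub>G\<^esub> F z)"
    by (rule finsum_cong')
       (use pow US F in \<open>auto simp: Poly_Mapping.lookup_add add.int_pow_mult subset_iff\<close>)
  also have "\<dots> = (\<Oplus>\<^bsub>G\<^esub>z\<in>?U. [Poly_Mapping.lookup c z] \<cdot>\<^bsub>G\<^esub> F z)
      \<oplus>\<^bsub>G\<^esub> (\<Oplus>\<^bsub>G\<^esub>z\<in>?U. [Poly_Mapping.lookup d z] \<cdot>\<^bsub>G\<^esub> F z)"
    by (rule finsum_addf) (use pow US in auto)
  also have "\<dots> = ?h c \<oplus>\<^bsub>G\<^esub> ?h d"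
    using ext[of c] ext[of d] by simp
  finally show "?h (c \<otimes>\<^bsub>free_Abelian_group S\<^esub> d) = ?h c \<otimes>\<^bsub>add_monoid G\<^esub> ?h d"
    by simp
qed

lemma (in abelian_group) frag_extension_of:
  assumes "F z \<in> carrier G"
  shows "(\<Oplus>\<^bsub>G\<^esub>w\<in>Poly_Mapping.keys (frag_of z). [Poly_Mapping.lookup (frag_of z) w] \<cdot>\<^bsub>G\<^esub> F w) = F z"
  using assms by (simp add: finsum_singleton add.int_pow_1)

text \<open>A lift depends only on carrier, addition and zero of its target. The actions in
  \<open>tensor\<close> are defined by lifts into the auxiliary record \<open>tensor_group\<close>;
  this lets them be read as lifts into \<open>tensor\<close> itself.\<close>

lemma tensor_lift_cong_group:
  assumes "carrier G = carrier H" "add G = add H" "\<zero>\<^bsub>G\<^esub> = \<zero>\<^bsub>H\<^esub>"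
  shows "tensor_lift G f = tensor_lift H f"
proof -
  have inv: "m_inv (add_monoid G) = m_inv (add_monoid H)"
    using assms by (intro ext) (simp add: m_inv_def)
  show ?thesis
    unfolding tensor_lift_def finsum_def finprod_def add_pow_def int_pow_def nat_pow_def inv
    using assms by simp
qed

lemma abelian_group_cong:
  assumes "abelian_group G" and eq: "carrier G = carrier H" "add G = add H"
    "\<zero>\<^bsub>G\<^esub> = \<zero>\<^bsub>H\<^esub>"
  shows "abelian_group H"
proof -
  interpret G: abelian_group G by fact
  note eq [symmetric, simp]
  show ?thesis
  proof (rule abelian_groupI)
    show "\<exists>y\<in>carrier H. y \<oplus>\<^bsub>H\<^esub> x = \<zero>\<^bsub>H\<^esub>" if "x \<in> carrier H" for x
      using that G.add.l_inv_ex by simp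
  qed (simp_all add: G.a_ac)
qed

text \<open>The condition on \<open>K\<close> and \<open>\<phi>\<close> is only that scalars land in
  \<open>A\<close>, so one locale covers tensor products over \<open>R\<close> via
  \<open>\<alpha>\<close>, over \<open>S\<close> via \<open>\<beta>\<close>, and over
  \<open>A\<close> or \<open>B\<close> via \<open>id\<close>.\<close>

locale tensor_product = M: bimodule L A M + N: bimodule A Q N
  for L :: "('l, 'v) ring_scheme" and A :: "('a, 'w) ring_scheme" and Q :: "('r, 'x) ring_scheme"
    and M :: "('l, 'a, 'm) bimod" and N :: "('a, 'r, 'n) bimod" +
  fixes K :: "('k, 'y) ring_scheme" and \<phi> :: "'k \<Rightarrow> 'a"
  assumes scalars: "k \<in> carrier K \<Longrightarrow> \<phi> k \<in> carrier A"

text \<open>The hypothesis of the universal property. Every clause is relative to the carriers,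
  because nothing is known about \<open>f\<close> elsewhere on the types.\<close>

definition balanced ::
  "('k, 'x) ring_scheme \<Rightarrow> ('k \<Rightarrow> 'a) \<Rightarrow> ('l, 'a, 'm) bimod \<Rightarrow> ('a, 'r, 'n) bimod
     \<Rightarrow> ('g, 'y) ring_scheme \<Rightarrow> ('m \<Rightarrow> 'n \<Rightarrow> 'g) \<Rightarrow> bool" where
  "balanced K \<phi> M N G f \<longleftrightarrow>
     (\<forall>x\<in>carrier M. \<forall>y\<in>carrier N. f x y \<in> carrier G) \<and>
     (\<forall>x\<in>carrier M. \<forall>x'\<in>carrier M. \<forall>y\<in>carrier N. f (x \<oplus>\<^bsub>M\<^esub> x') y = f x y \<oplus>\<^bsub>G\<^esub> f x' y) \<and>
     (\<forall>x\<in>carrier M. \<forall>y\<in>carrier N. \<forall>y'\<in>carrier N. f x (y \<oplus>\<^bsub>N\<^esub> y') = f x y \<oplus>\<^bsub>G\<^esub> f x y') \<and>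
     (\<forall>x\<in>carrier M. \<forall>k\<in>carrier K. \<forall>y\<in>carrier N. f (x \<triangleleft>\<^bsub>M\<^esub> \<phi> k) y = f x (\<phi> k \<triangleright>\<^bsub>N\<^esub> y))"

section \<open>The quotient group and its universal property\<close>

context tensor_product
begin

lemma scalar_closed [simp]:
  "\<lbrakk>x \<in> carrier M; k \<in> carrier K\<rbrakk> \<Longrightarrow> x \<triangleleft>\<^bsub>M\<^esub> \<phi> k \<in> carrier M"
  "\<lbrakk>y \<in> carrier N; k \<in> carrier K\<rbrakk> \<Longrightarrow> \<phi> k \<triangleright>\<^bsub>N\<^esub> y \<in> carrier N"
  by (simp_all add: M.ract_closed N.lact_closed scalars)

lemma relations_subset: "tensor_relations K \<phi> M N \<subseteq> carrier (tensor_free M N)"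
  unfolding tensor_relations_def tensor_free_def
  by (intro subsetI; elim UnE CollectE exE conjE; simp only: carrier_free_Abelian_group_iff)
     (intro keys_diff_subset; simp)+

lemma kernel_normal: "tensor_kernel K \<phi> M N \<lhd> tensor_free M N"
proof -
  interpret F: comm_group "tensor_free M N"
    unfolding tensor_free_def by (rule abelian_free_Abelian_group)
  show ?thesis
    unfolding tensor_kernel_def
    using F.generate_is_subgroup[OF relations_subset] F.normal_iff_subgroup by blast
qed

interpretation kernel: normal "tensor_kernel K \<phi> M N" "tensor_free M N"
  by (rule kernel_normal)

lemma tensor_group_abelian: "abelian_group (tensor_group K \<phi> M N)"
proof -
  interpret F: comm_group "tensor_free M N"
    unfolding tensor_free_def by (rule abelian_free_Abelian_group)
  interpret Q: comm_group "tensor_free M N Mod tensor_kernel K \<phi> M N"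
    using kernel_normal F.abelian_FactGroup normal_imp_subgroup by blast
  show ?thesis
    by (rule abelian_groupI)
       (use Q.m_assoc Q.m_comm Q.l_inv_ex in
         \<open>simp_all add: tensor_group_def Let_def del: mult_FactGroup one_FactGroup\<close>)
qed

lemma tensor_simps:
  "carrier (tensor K \<phi> M N) = carrier (tensor_group K \<phi> M N)"
  "add (tensor K \<phi> M N) = add (tensor_group K \<phi> M N)"
  "\<zero>\<^bsub>tensor K \<phi> M N\<^esub> = \<zero>\<^bsub>tensor_group K \<phi> M N\<^esub>"
  by (simp_all add: tensor_def Let_def)

lemma tensor_abelian: "abelian_group (tensor K \<phi> M N)"
  using tensor_group_abelian by (rule abelian_group_cong) (simp_all add: tensor_simps)

sublocale abelian_group "tensor K \<phi> M N"
  by (rule tensor_abelian)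

text \<open>Extends \<open>pure_tensor\<close> from a single generator to an arbitrary formal sum,
  so that statements about tensors can be reduced to statements about representatives.\<close>

definition cls :: "('m \<times> 'n \<Rightarrow>\<^sub>0 int) \<Rightarrow> ('m, 'n) tens" where
  "cls c = tensor_kernel K \<phi> M N #>\<^bsub>tensor_free M N\<^esub> c"

lemma carrier_tensor:
  "carrier (tensor K \<phi> M N) = cls ` {c. Poly_Mapping.keys c \<subseteq> carrier M \<times> carrier N}"
  by (auto simp: tensor_simps tensor_group_def Let_def carrier_FactGroup cls_def tensor_free_def)

lemma cls_closed:
  "Poly_Mapping.keys c \<subseteq> carrier M \<times> carrier N \<Longrightarrow> cls c \<in> carrier (tensor K \<phi> M N)"
  by (auto simp: carrier_tensor)

lemma cls_add:
  assumes "Poly_Mapping.keys c \<subseteq> carrier M \<times> carrier N" "Poly_Mapping.keys d \<subseteq> carrier M \<times> carrier N"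
  shows "cls (c + d) = cls c \<oplus>\<^bsub>tensor K \<phi> M N\<^esub> cls d"
  using kernel.rcos_sum[of c d] assms
  by (simp add: tensor_simps tensor_group_def Let_def cls_def tensor_free_def)

lemma cls_minus:
  assumes "Poly_Mapping.keys c \<subseteq> carrier M \<times> carrier N"
  shows "cls (- c) = \<ominus>\<^bsub>tensor K \<phi> M N\<^esub> cls c"
proof -
  have m: "Poly_Mapping.keys (- c) \<subseteq> carrier M \<times> carrier N"
    using assms by simp
  have z: "cls 0 \<oplus>\<^bsub>tensor K \<phi> M N\<^esub> cls 0 = cls 0"
    using cls_add[of 0 0] by simp
  have "cls 0 = \<zero>\<^bsub>tensor K \<phi> M N\<^esub>"
    using z cls_closed[of 0] by (metis add.l_cancel_one' keys_zero empty_subsetI)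
  then have "cls c \<oplus>\<^bsub>tensor K \<phi> M N\<^esub> cls (- c) = \<zero>\<^bsub>tensor K \<phi> M N\<^esub>"
    using cls_add[OF assms m] by simp
  then show ?thesis
    using cls_closed[OF assms] cls_closed[OF m] by (metis minus_equality a_comm)
qed

lemma cls_eqI:
  assumes "Poly_Mapping.keys c \<subseteq> carrier M \<times> carrier N" "Poly_Mapping.keys d \<subseteq> carrier M \<times> carrier N"
    and "c - d \<in> tensor_relations K \<phi> M N"
  shows "cls c = cls d"
proof -
  have "c - d \<in> tensor_kernel K \<phi> M N"
    using assms(3) by (simp add: tensor_kernel_def generate.incl)
  then have "c \<in> tensor_kernel K \<phi> M N #>\<^bsub>tensor_free M N\<^esub> d"
    by (force simp: r_coset_def tensor_free_def)
  then show ?thesis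
    unfolding cls_def
    by (rule kernel.repr_independence [OF _ _ kernel.is_subgroup, symmetric])
       (use assms(2) in \<open>simp add: tensor_free_def\<close>)
qed

lemma pure_cls: "pure_tensor K \<phi> M N x y = cls (frag_of (x, y))"
  by (simp add: pure_tensor_def cls_def)

lemma pure_closed [simp]:
  "\<lbrakk>x \<in> carrier M; y \<in> carrier N\<rbrakk> \<Longrightarrow> pure_tensor K \<phi> M N x y \<in> carrier (tensor K \<phi> M N)"
  unfolding pure_cls by (rule cls_closed) simp

lemma pure_add_left [simp]:
  assumes "x \<in> carrier M" "x' \<in> carrier M" "y \<in> carrier N"
  shows "pure_tensor K \<phi> M N (x \<oplus>\<^bsub>M\<^esub> x') y
    = pure_tensor K \<phi> M N x y \<oplus>\<^bsub>tensor K \<phi> M N\<^esub> pure_tensor K \<phi> M N x' y"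
proof -
  have "cls (frag_of (x \<oplus>\<^bsub>M\<^esub> x', y)) = cls (frag_of (x, y) + frag_of (x', y))"
  proof (rule cls_eqI)
    show "frag_of (x \<oplus>\<^bsub>M\<^esub> x', y) - (frag_of (x, y) + frag_of (x', y)) \<in> tensor_relations K \<phi> M N"
      unfolding tensor_relations_def diff_diff_eq [symmetric] using assms by blast
  qed (use assms in \<open>simp_all add: keys_add_subset\<close>)
  then show ?thesis
    using assms by (simp add: pure_cls cls_add)
qed

lemma pure_add_right [simp]:
  assumes "x \<in> carrier M" "y \<in> carrier N" "y' \<in> carrier N"
  shows "pure_tensor K \<phi> M N x (y \<oplus>\<^bsub>N\<^esub> y')
    = pure_tensor K \<phi> M N x y \<oplus>\<^bsub>tensor K \<phi> M N\<^esub> pure_tensor K \<phi> M N x y'"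
proof -
  have "cls (frag_of (x, y \<oplus>\<^bsub>N\<^esub> y')) = cls (frag_of (x, y) + frag_of (x, y'))"
  proof (rule cls_eqI)
    show "frag_of (x, y \<oplus>\<^bsub>N\<^esub> y') - (frag_of (x, y) + frag_of (x, y')) \<in> tensor_relations K \<phi> M N"
      unfolding tensor_relations_def diff_diff_eq [symmetric] using assms by blast
  qed (use assms in \<open>simp_all add: keys_add_subset\<close>)
  then show ?thesis
    using assms by (simp add: pure_cls cls_add)
qed

lemma pure_balanced:
  assumes "x \<in> carrier M" "k \<in> carrier K" "y \<in> carrier N"
  shows "pure_tensor K \<phi> M N (x \<triangleleft>\<^bsub>M\<^esub> \<phi> k) y = pure_tensor K \<phi> M N x (\<phi> k \<triangleright>\<^bsub>N\<^esub> y)"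
  unfolding pure_cls
proof (rule cls_eqI)
  show "frag_of (x \<triangleleft>\<^bsub>M\<^esub> \<phi> k, y) - frag_of (x, \<phi> k \<triangleright>\<^bsub>N\<^esub> y) \<in> tensor_relations K \<phi> M N"
    unfolding tensor_relations_def using assms by blast
qed (use assms in auto)

text \<open>Zero and negatives need no case of their own: 0 \<otimes> y is zero and the negative of
  x \<otimes> y is (-x) \<otimes> y, so every element is a sum of pure tensors. Nearly every later
  identity between additive maps is proved by this rule.\<close>

lemma tensor_induct [consumes 1, case_names pure add]:
  assumes X: "X \<in> carrier (tensor K \<phi> M N)"
    and pure: "\<And>x y. \<lbrakk>x \<in> carrier M; y \<in> carrier N\<rbrakk> \<Longrightarrow> P (pure_tensor K \<phi> M N x y)"
    and add: "\<And>X Y. \<lbrakk>X \<in> carrier (tensor K \<phi> M N); Y \<in> carrier (tensor K \<phi> M N); P X; P Y\<rbrakk>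
      \<Longrightarrow> P (X \<oplus>\<^bsub>tensor K \<phi> M N\<^esub> Y)"
  shows "P X"
proof -
  let ?S = "carrier M \<times> carrier N"
  have minus: "\<ominus>\<^bsub>tensor K \<phi> M N\<^esub> pure_tensor K \<phi> M N x y = pure_tensor K \<phi> M N (\<ominus>\<^bsub>M\<^esub> x) y"
    and pure_zero: "pure_tensor K \<phi> M N \<zero>\<^bsub>M\<^esub> y = \<zero>\<^bsub>tensor K \<phi> M N\<^esub>"
    if xy: "x \<in> carrier M" "y \<in> carrier N" for x y
  proof -
    have "pure_tensor K \<phi> M N \<zero>\<^bsub>M\<^esub> y \<oplus>\<^bsub>tensor K \<phi> M N\<^esub> pure_tensor K \<phi> M N \<zero>\<^bsub>M\<^esub> y
        = pure_tensor K \<phi> M N \<zero>\<^bsub>M\<^esub> y"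
      using pure_add_left[of "\<zero>\<^bsub>M\<^esub>" "\<zero>\<^bsub>M\<^esub>" y] xy by (simp del: pure_add_left)
    then show z: "pure_tensor K \<phi> M N \<zero>\<^bsub>M\<^esub> y = \<zero>\<^bsub>tensor K \<phi> M N\<^esub>"
      using xy by simp
    have "pure_tensor K \<phi> M N (\<ominus>\<^bsub>M\<^esub> x) y \<oplus>\<^bsub>tensor K \<phi> M N\<^esub> pure_tensor K \<phi> M N x y
        = \<zero>\<^bsub>tensor K \<phi> M N\<^esub>"
      using pure_add_left[of "\<ominus>\<^bsub>M\<^esub> x" x y] xy z by (simp del: pure_add_left add: M.M.l_neg)
    then show "\<ominus>\<^bsub>tensor K \<phi> M N\<^esub> pure_tensor K \<phi> M N x y = pure_tensor K \<phi> M N (\<ominus>\<^bsub>M\<^esub> x) y"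
      using xy by (simp add: minus_equality)
  qed
  \<comment> \<open>Induction on the free abelian group has a case for differences, while
    \<open>P\<close> is only known to pass to sums. Carrying \<open>c\<close> and \<open>- c\<close>
    together turns c - d into c + (-d), and its negative into (-c) + d.\<close>
  have "P (cls c) \<and> P (cls (- c))" if "Poly_Mapping.keys c \<subseteq> ?S" for c
    using that
  proof (induction c rule: free_Abelian_group_induct [consumes 1, case_names zero diff of])
    case zero
    have "P \<zero>\<^bsub>tensor K \<phi> M N\<^esub>"
      using pure[OF M.M.zero_closed N.M.zero_closed]
      by (simp only: pure_zero[OF M.M.zero_closed N.M.zero_closed])
    moreover have "cls 0 = \<zero>\<^bsub>tensor K \<phi> M N\<^esub>"
      by (simp add: tensor_simps tensor_group_def Let_def cls_def tensor_free_def)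
         (metis kernel.is_subgroup kernel.subset group.coset_join2 group_free_Abelian_group
           one_free_Abelian_group subgroup.one_closed subgroup.mem_carrier tensor_free_def)
    ultimately show ?case by simp
  next
    case (diff c d)
    have "cls (c - d) = cls c \<oplus>\<^bsub>tensor K \<phi> M N\<^esub> cls (- d)"
      "cls (- (c - d)) = cls (- c) \<oplus>\<^bsub>tensor K \<phi> M N\<^esub> cls d"
      using diff cls_add[of c "- d"] cls_add[of "- c" d] by (auto simp: algebra_simps)
    then show ?case
      using diff cls_closed by (auto intro!: add)
  next
    case (of z)
    then show ?case
      using pure minus cls_minus[of "frag_of z"] by (cases z) (auto simp flip: pure_cls)
  qed
  then show ?thesis
    using X by (auto simp: carrier_tensor)
qed

text \<open>\<open>tensor_lift\<close> evaluates at a chosen representative. The additive extension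
  of a balanced \<open>f\<close> kills each defining relation, hence the subgroup they generate, and
  is therefore constant on every coset.\<close>

lemma tensor_lift_cls:
  assumes G: "abelian_group G" and f: "balanced K \<phi> M N G f"
    and c: "Poly_Mapping.keys c \<subseteq> carrier M \<times> carrier N"
  shows "tensor_lift G f (cls c)
    = (\<Oplus>\<^bsub>G\<^esub>z\<in>Poly_Mapping.keys c. [Poly_Mapping.lookup c z] \<cdot>\<^bsub>G\<^esub> f (fst z) (snd z))"
    (is "_ = ?h c")
proof -
  interpret G: abelian_group G by (rule G)
  have hom: "?h \<in> hom (tensor_free M N) (add_monoid G)"
    unfolding tensor_free_def using f by (intro G.frag_extension_hom) (auto simp: balanced_def)
  interpret h: group_hom "tensor_free M N" "add_monoid G" ?h
    using hom by (auto simp: group_hom_def group_hom_axioms_def kernel.is_group G.a_group)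
  have kernel: "subgroup (kernel (tensor_free M N) (add_monoid G) ?h) (tensor_free M N)"
    by (rule h.subgroup_kernel)
  have gen: "?h (frag_of (x, y)) = f x y" if "x \<in> carrier M" "y \<in> carrier N" for x y
    using G.frag_extension_of[of "\<lambda>z. f (fst z) (snd z)" "(x, y)"] f that by (auto simp: balanced_def)
  have hadd: "?h (a + b) = ?h a \<oplus>\<^bsub>G\<^esub> ?h b"
    if "a \<in> carrier (tensor_free M N)" "b \<in> carrier (tensor_free M N)" for a b
    using h.hom_mult[OF that] by (simp add: tensor_free_def)
  have hdiff: "?h (a - b) = \<zero>\<^bsub>G\<^esub>"
    if "a \<in> carrier (tensor_free M N)" "b \<in> carrier (tensor_free M N)" "?h a = ?h b" for a b
  proof -
    have "a - b \<in> carrier (tensor_free M N)"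
      using that keys_diff[of a b] by (auto simp: tensor_free_def)
    then have "?h (a - b) \<oplus>\<^bsub>G\<^esub> ?h b = ?h b" "?h (a - b) \<in> carrier G" "?h b \<in> carrier G"
      using hadd[of "a - b" b] that h.hom_closed[of "a - b"] h.hom_closed[of b] by simp_all
    then show ?thesis by simp
  qed
  have frag2: "frag_of p + frag_of q \<in> carrier (tensor_free M N)"
    if "p \<in> carrier M \<times> carrier N" "q \<in> carrier M \<times> carrier N" for p q
    using that by (simp add: tensor_free_def keys_add_subset)
  have rel: "?h r = \<zero>\<^bsub>G\<^esub>" if r: "r \<in> tensor_relations K \<phi> M N" for r
  proof -
    \<comment> \<open>Each relation is regrouped as a difference of two terms, the second possibly a
      sum, so that \<open>hdiff\<close> reduces it to the matching clause of
      \<open>balanced\<close>.\<close>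
    consider x x' y where "r = frag_of (x \<oplus>\<^bsub>M\<^esub> x', y) - (frag_of (x, y) + frag_of (x', y))"
        "x \<in> carrier M" "x' \<in> carrier M" "y \<in> carrier N"
      | x y y' where "r = frag_of (x, y \<oplus>\<^bsub>N\<^esub> y') - (frag_of (x, y) + frag_of (x, y'))"
        "x \<in> carrier M" "y \<in> carrier N" "y' \<in> carrier N"
      | x k y where "r = frag_of (x \<triangleleft>\<^bsub>M\<^esub> \<phi> k, y) - frag_of (x, \<phi> k \<triangleright>\<^bsub>N\<^esub> y)"
        "x \<in> carrier M" "k \<in> carrier K" "y \<in> carrier N"
      using r unfolding tensor_relations_def diff_diff_eq by (elim UnE CollectE exE conjE)
    then show ?thesis
    proof cases
      case 1
      then show ?thesis
        using f by (auto simp: balanced_def hadd gen tensor_free_def intro!: hdiff frag2)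
    next
      case 2
      then show ?thesis
        using f by (auto simp: balanced_def hadd gen tensor_free_def intro!: hdiff frag2)
    next
      case 3
      then show ?thesis
        using f by (auto simp: balanced_def gen tensor_free_def intro!: hdiff)
    qed
  qed
  have "tensor_kernel K \<phi> M N \<subseteq> kernel (tensor_free M N) (add_monoid G) ?h"
    unfolding tensor_kernel_def
    by (rule kernel.generate_subgroup_incl[OF _ kernel]) (use rel relations_subset in \<open>auto simp: kernel_def\<close>)
  then have ker: "?h k = \<zero>\<^bsub>G\<^esub>" "k \<in> carrier (tensor_free M N)" if "k \<in> tensor_kernel K \<phi> M N" for k
    using that by (auto simp: kernel_def)
  have cF: "c \<in> carrier (tensor_free M N)" using c by (simp add: tensor_free_def)
  have const: "?h d = ?h c" if d: "d \<in> cls c" for d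
  proof -
    obtain k where k: "k \<in> tensor_kernel K \<phi> M N" "d = k + c"
      using d by (auto simp: cls_def r_coset_def tensor_free_def)
    show ?thesis
      using hadd[of k c] ker[OF k(1)] k(2) cF h.hom_closed[OF cF] by simp
  qed
  have "c \<in> cls c"
    unfolding cls_def by (rule kernel.rcos_self[OF cF kernel.is_subgroup])
  then have "(SOME d. d \<in> cls c) \<in> cls c" by (rule someI)
  then show ?thesis
    unfolding tensor_lift_def Let_def by (rule const)
qed

lemma lift_pure:
  assumes "abelian_group G" "balanced K \<phi> M N G f" "x \<in> carrier M" "y \<in> carrier N"
  shows "tensor_lift G f (pure_tensor K \<phi> M N x y) = f x y"
proof -
  interpret G: abelian_group G by fact
  have "f x y \<in> carrier G" using assms by (auto simp: balanced_def)
  then show ?thesis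
    using tensor_lift_cls[of G f "frag_of (x, y)"] assms
      G.frag_extension_of[of "\<lambda>z. f (fst z) (snd z)" "(x, y)"]
    by (simp add: pure_cls)
qed

text \<open>Since any representative may be used, a sum of classes is evaluated at the sum of their
  representatives. With \<open>lift_pure\<close> this is the existence half of the universal
  property; uniqueness is supplied by \<open>tensor_induct\<close>.\<close>

lemma lift_hom_add_monoid:
  assumes "abelian_group G" "balanced K \<phi> M N G f"
  shows "X \<in> carrier (tensor K \<phi> M N) \<Longrightarrow> tensor_lift G f X \<in> carrier G"
    and "\<lbrakk>X \<in> carrier (tensor K \<phi> M N); Y \<in> carrier (tensor K \<phi> M N)\<rbrakk>
      \<Longrightarrow> tensor_lift G f (X \<oplus>\<^bsub>tensor K \<phi> M N\<^esub> Y) = tensor_lift G f X \<oplus>\<^bsub>G\<^esub> tensor_lift G f Y"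
proof -
  interpret G: abelian_group G by fact
  have hom: "(\<lambda>c. \<Oplus>\<^bsub>G\<^esub>z\<in>Poly_Mapping.keys c. [Poly_Mapping.lookup c z] \<cdot>\<^bsub>G\<^esub> f (fst z) (snd z))
      \<in> hom (tensor_free M N) (add_monoid G)"
    unfolding tensor_free_def using assms by (intro G.frag_extension_hom) (auto simp: balanced_def)
  show "tensor_lift G f X \<in> carrier G" if "X \<in> carrier (tensor K \<phi> M N)"
    using that hom_in_carrier[OF hom] tensor_lift_cls[OF assms]
    by (auto simp: carrier_tensor tensor_free_def)
  show "tensor_lift G f (X \<oplus>\<^bsub>tensor K \<phi> M N\<^esub> Y) = tensor_lift G f X \<oplus>\<^bsub>G\<^esub> tensor_lift G f Y"
    if XY: "X \<in> carrier (tensor K \<phi> M N)" "Y \<in> carrier (tensor K \<phi> M N)"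
  proof -
    obtain c d where cd: "X = cls c" "Y = cls d" "Poly_Mapping.keys c \<subseteq> carrier M \<times> carrier N"
      "Poly_Mapping.keys d \<subseteq> carrier M \<times> carrier N"
      using XY by (auto simp: carrier_tensor)
    have "Poly_Mapping.keys (c + d) \<subseteq> carrier M \<times> carrier N"
      using cd keys_add[of c d] by blast
    then show ?thesis
      using cd hom_mult[OF hom, of c d] tensor_lift_cls[OF assms]
      by (simp add: tensor_free_def flip: cls_add)
  qed
qed

end

section \<open>Additive and balanced maps\<close>

lemma add_hom_closed: "\<lbrakk>f \<in> add_hom M N; x \<in> carrier M\<rbrakk> \<Longrightarrow> f x \<in> carrier N"
  by (auto simp: add_hom_def)

lemma add_hom_add:
  "\<lbrakk>f \<in> add_hom M N; x \<in> carrier M; y \<in> carrier M\<rbrakk> \<Longrightarrow> f (x \<oplus>\<^bsub>M\<^esub> y) = f x \<oplus>\<^bsub>N\<^esub> f y"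
  by (auto simp: add_hom_def)

lemma add_homI:
  assumes "\<And>x. x \<in> carrier M \<Longrightarrow> f x \<in> carrier N"
    and "\<And>x y. \<lbrakk>x \<in> carrier M; y \<in> carrier M\<rbrakk> \<Longrightarrow> f (x \<oplus>\<^bsub>M\<^esub> y) = f x \<oplus>\<^bsub>N\<^esub> f y"
  shows "f \<in> add_hom M N"
  using assms by (auto simp: add_hom_def)

lemma id_add_hom: "id \<in> add_hom M M"
  by (rule add_homI) simp_all

lemma balancedI:
  assumes "\<And>x y. \<lbrakk>x \<in> carrier M; y \<in> carrier N\<rbrakk> \<Longrightarrow> f x y \<in> carrier G"
    and "\<And>x x' y. \<lbrakk>x \<in> carrier M; x' \<in> carrier M; y \<in> carrier N\<rbrakk> \<Longrightarrow> f (x \<oplus>\<^bsub>M\<^esub> x') y = f x y \<oplus>\<^bsub>G\<^esub> f x' y"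
    and "\<And>x y y'. \<lbrakk>x \<in> carrier M; y \<in> carrier N; y' \<in> carrier N\<rbrakk> \<Longrightarrow> f x (y \<oplus>\<^bsub>N\<^esub> y') = f x y \<oplus>\<^bsub>G\<^esub> f x y'"
    and "\<And>x k y. \<lbrakk>x \<in> carrier M; k \<in> carrier K; y \<in> carrier N\<rbrakk> \<Longrightarrow> f (x \<triangleleft>\<^bsub>M\<^esub> \<phi> k) y = f x (\<phi> k \<triangleright>\<^bsub>N\<^esub> y)"
  shows "balanced K \<phi> M N G f"
  using assms by (auto simp: balanced_def)

lemma balancedD:
  assumes "balanced K \<phi> M N G f"
  shows "\<And>x y. \<lbrakk>x \<in> carrier M; y \<in> carrier N\<rbrakk> \<Longrightarrow> f x y \<in> carrier G"
    and "\<And>x x' y. \<lbrakk>x \<in> carrier M; x' \<in> carrier M; y \<in> carrier N\<rbrakk> \<Longrightarrow> f (x \<oplus>\<^bsub>M\<^esub> x') y = f x y \<oplus>\<^bsub>G\<^esub> f x' y"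
    and "\<And>x y y'. \<lbrakk>x \<in> carrier M; y \<in> carrier N; y' \<in> carrier N\<rbrakk> \<Longrightarrow> f x (y \<oplus>\<^bsub>N\<^esub> y') = f x y \<oplus>\<^bsub>G\<^esub> f x y'"
    and "\<And>x k y. \<lbrakk>x \<in> carrier M; k \<in> carrier K; y \<in> carrier N\<rbrakk> \<Longrightarrow> f (x \<triangleleft>\<^bsub>M\<^esub> \<phi> k) y = f x (\<phi> k \<triangleright>\<^bsub>N\<^esub> y)"
  using assms by (auto simp: balanced_def)

declare (in left_module) lact_closed [simp] lact_add [simp] one_lact [simp]
declare (in right_module) ract_closed [simp] ract_add [simp] one_ract [simp]

section \<open>Bimodule structure and functoriality of the tensor product\<close>

context tensor_product
begin

lemma lift_hom:
  assumes "abelian_group G" "balanced K \<phi> M N G f"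
  shows "tensor_lift G f \<in> add_hom (tensor K \<phi> M N) G"
  using lift_hom_add_monoid[OF assms] by (rule add_homI)

lemma tensor_lift_group: "tensor_lift (tensor_group K \<phi> M N) f = tensor_lift (tensor K \<phi> M N) f"
  by (rule tensor_lift_cong_group) (simp_all add: tensor_simps)

lemma lact_tensor:
  "a \<triangleright>\<^bsub>tensor K \<phi> M N\<^esub> X
    = tensor_lift (tensor K \<phi> M N) (\<lambda>x y. pure_tensor K \<phi> M N (a \<triangleright>\<^bsub>M\<^esub> x) y) X"
  unfolding tensor_lift_group [symmetric] by (simp add: tensor_def Let_def)

lemma ract_tensor:
  "X \<triangleleft>\<^bsub>tensor K \<phi> M N\<^esub> b
    = tensor_lift (tensor K \<phi> M N) (\<lambda>x y. pure_tensor K \<phi> M N x (y \<triangleleft>\<^bsub>N\<^esub> b)) X"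
  unfolding tensor_lift_group [symmetric] by (simp add: tensor_def Let_def)

text \<open>Multiplying the first factor from the left respects the middle relation because the two
  actions on \<open>M\<close> commute.\<close>

lemma lact_balanced:
  "a \<in> carrier L \<Longrightarrow>
    balanced K \<phi> M N (tensor K \<phi> M N) (\<lambda>x y. pure_tensor K \<phi> M N (a \<triangleright>\<^bsub>M\<^esub> x) y)"
  by (rule balancedI) (simp_all add: M.lact_ract [symmetric] scalars pure_balanced)

lemma ract_balanced:
  "b \<in> carrier Q \<Longrightarrow>
    balanced K \<phi> M N (tensor K \<phi> M N) (\<lambda>x y. pure_tensor K \<phi> M N x (y \<triangleleft>\<^bsub>N\<^esub> b))"
  by (rule balancedI) (simp_all add: N.lact_ract scalars pure_balanced)

lemma lact_pure [simp]:
  "\<lbrakk>a \<in> carrier L; x \<in> carrier M; y \<in> carrier N\<rbrakk>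
    \<Longrightarrow> a \<triangleright>\<^bsub>tensor K \<phi> M N\<^esub> pure_tensor K \<phi> M N x y = pure_tensor K \<phi> M N (a \<triangleright>\<^bsub>M\<^esub> x) y"
  unfolding lact_tensor by (rule lift_pure [OF tensor_abelian lact_balanced])

lemma ract_pure [simp]:
  "\<lbrakk>b \<in> carrier Q; x \<in> carrier M; y \<in> carrier N\<rbrakk>
    \<Longrightarrow> pure_tensor K \<phi> M N x y \<triangleleft>\<^bsub>tensor K \<phi> M N\<^esub> b = pure_tensor K \<phi> M N x (y \<triangleleft>\<^bsub>N\<^esub> b)"
  unfolding ract_tensor by (rule lift_pure [OF tensor_abelian ract_balanced])

lemmas lact_hom = lift_hom_add_monoid [OF tensor_abelian lact_balanced, folded lact_tensor]
lemmas ract_hom = lift_hom_add_monoid [OF tensor_abelian ract_balanced, folded ract_tensor]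

lemma tensor_bimodule: "bimodule L Q (tensor K \<phi> M N)"
proof -
  note [simp] = lact_hom ract_hom
  have add: "(a \<oplus>\<^bsub>L\<^esub> b) \<triangleright>\<^bsub>tensor K \<phi> M N\<^esub> X
      = (a \<triangleright>\<^bsub>tensor K \<phi> M N\<^esub> X) \<oplus>\<^bsub>tensor K \<phi> M N\<^esub> (b \<triangleright>\<^bsub>tensor K \<phi> M N\<^esub> X)"
    if "X \<in> carrier (tensor K \<phi> M N)" "a \<in> carrier L" "b \<in> carrier L" for a b X
    using that by (induction X rule: tensor_induct) (simp_all add: M.add_lact a_ac)
  have mult: "(a \<otimes>\<^bsub>L\<^esub> b) \<triangleright>\<^bsub>tensor K \<phi> M N\<^esub> X
      = a \<triangleright>\<^bsub>tensor K \<phi> M N\<^esub> (b \<triangleright>\<^bsub>tensor K \<phi> M N\<^esub> X)"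
    if "X \<in> carrier (tensor K \<phi> M N)" "a \<in> carrier L" "b \<in> carrier L" for a b X
    using that by (induction X rule: tensor_induct) (simp_all add: M.mult_lact)
  have one: "\<one>\<^bsub>L\<^esub> \<triangleright>\<^bsub>tensor K \<phi> M N\<^esub> X = X" if "X \<in> carrier (tensor K \<phi> M N)" for X
    using that by (induction X rule: tensor_induct) simp_all
  have radd: "X \<triangleleft>\<^bsub>tensor K \<phi> M N\<^esub> (a \<oplus>\<^bsub>Q\<^esub> b)
      = (X \<triangleleft>\<^bsub>tensor K \<phi> M N\<^esub> a) \<oplus>\<^bsub>tensor K \<phi> M N\<^esub> (X \<triangleleft>\<^bsub>tensor K \<phi> M N\<^esub> b)"
    if "X \<in> carrier (tensor K \<phi> M N)" "a \<in> carrier Q" "b \<in> carrier Q" for a b X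
    using that by (induction X rule: tensor_induct) (simp_all add: N.add_ract a_ac)
  have rmult: "X \<triangleleft>\<^bsub>tensor K \<phi> M N\<^esub> (a \<otimes>\<^bsub>Q\<^esub> b)
      = (X \<triangleleft>\<^bsub>tensor K \<phi> M N\<^esub> a) \<triangleleft>\<^bsub>tensor K \<phi> M N\<^esub> b"
    if "X \<in> carrier (tensor K \<phi> M N)" "a \<in> carrier Q" "b \<in> carrier Q" for a b X
    using that by (induction X rule: tensor_induct) (simp_all add: N.mult_ract)
  have rone: "X \<triangleleft>\<^bsub>tensor K \<phi> M N\<^esub> \<one>\<^bsub>Q\<^esub> = X" if "X \<in> carrier (tensor K \<phi> M N)" for X
    using that by (induction X rule: tensor_induct) simp_all
  have comm: "(a \<triangleright>\<^bsub>tensor K \<phi> M N\<^esub> X) \<triangleleft>\<^bsub>tensor K \<phi> M N\<^esub> b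
      = a \<triangleright>\<^bsub>tensor K \<phi> M N\<^esub> (X \<triangleleft>\<^bsub>tensor K \<phi> M N\<^esub> b)"
    if "X \<in> carrier (tensor K \<phi> M N)" "a \<in> carrier L" "b \<in> carrier Q" for a b X
    using that by (induction X rule: tensor_induct) simp_all
  show ?thesis
    by unfold_locales (simp_all add: add mult radd rmult one rone comm)
qed

sublocale tensor: bimodule L Q "tensor K \<phi> M N"
  by (rule tensor_bimodule)

lemma pure_left_hom: "y \<in> carrier N \<Longrightarrow> (\<lambda>x. pure_tensor K \<phi> M N x y) \<in> add_hom M (tensor K \<phi> M N)"
  by (rule add_homI) simp_all

lemma pure_right_hom: "x \<in> carrier M \<Longrightarrow> pure_tensor K \<phi> M N x \<in> add_hom N (tensor K \<phi> M N)"
  by (rule add_homI) simp_all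

text \<open>The maps are only additive, and compatibility with scalars is a premise about tensors in
  the target. Source and target may thus be formed over different rings, which covers the canonical
  surjections as well as maps such as \<open>\<gamma>\<close> that are linear over the small rings
  only.\<close>

lemma map_hom:
  assumes target: "tensor_product L' A' Q' M' N' K' \<phi>'"
    and f: "f \<in> add_hom M M'" and g: "g \<in> add_hom N N'"
    and bal: "\<And>x k y. \<lbrakk>x \<in> carrier M; k \<in> carrier K; y \<in> carrier N\<rbrakk> \<Longrightarrow>
      pure_tensor K' \<phi>' M' N' (f (x \<triangleleft>\<^bsub>M\<^esub> \<phi> k)) (g y) = pure_tensor K' \<phi>' M' N' (f x) (g (\<phi> k \<triangleright>\<^bsub>N\<^esub> y))"
  shows "tensor_map K' \<phi>' M' N' f g \<in> add_hom (tensor K \<phi> M N) (tensor K' \<phi>' M' N')"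
    and "\<lbrakk>x \<in> carrier M; y \<in> carrier N\<rbrakk> \<Longrightarrow>
      tensor_map K' \<phi>' M' N' f g (pure_tensor K \<phi> M N x y) = pure_tensor K' \<phi>' M' N' (f x) (g y)"
proof -
  interpret T': tensor_product L' A' Q' M' N' K' \<phi>' by (rule target)
  note [simp] = add_hom_closed[OF f] add_hom_add[OF f] add_hom_closed[OF g] add_hom_add[OF g]
  have b: "balanced K \<phi> M N (tensor K' \<phi>' M' N') (\<lambda>x y. pure_tensor K' \<phi>' M' N' (f x) (g y))"
    by (rule balancedI) (simp_all add: bal)
  show "tensor_map K' \<phi>' M' N' f g \<in> add_hom (tensor K \<phi> M N) (tensor K' \<phi>' M' N')"
    unfolding tensor_map_def by (rule lift_hom[OF T'.tensor_abelian b])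
  show "tensor_map K' \<phi>' M' N' f g (pure_tensor K \<phi> M N x y) = pure_tensor K' \<phi>' M' N' (f x) (g y)"
    if "x \<in> carrier M" "y \<in> carrier N"
    unfolding tensor_map_def by (rule lift_pure[OF T'.tensor_abelian b that])
qed

end

text \<open>The special case of scalars from the middle ring itself, with \<open>id a\<close>
  simplified to \<open>a\<close> so that it matches as a rewrite rule.\<close>

lemma tensor_product_middle:
  assumes "tensor_product L A Q M N A id" "x \<in> carrier M" "a \<in> carrier A" "y \<in> carrier N"
  shows "pure_tensor A id M N (x \<triangleleft>\<^bsub>M\<^esub> a) y = pure_tensor A id M N x (a \<triangleright>\<^bsub>N\<^esub> y)"
  using tensor_product.pure_balanced[OF assms] by simp

lemmas (in tensor_product) lift_simps = lift_hom_add_monoid lift_pure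

lemma (in tensor_product) map_simps:
  assumes "tensor_product L' A' Q' M' N' K' \<phi>'" "f \<in> add_hom M M'" "g \<in> add_hom N N'"
    and "\<And>x k y. \<lbrakk>x \<in> carrier M; k \<in> carrier K; y \<in> carrier N\<rbrakk> \<Longrightarrow>
      pure_tensor K' \<phi>' M' N' (f (x \<triangleleft>\<^bsub>M\<^esub> \<phi> k)) (g y) = pure_tensor K' \<phi>' M' N' (f x) (g (\<phi> k \<triangleright>\<^bsub>N\<^esub> y))"
  shows "X \<in> carrier (tensor K \<phi> M N)
      \<Longrightarrow> tensor_map K' \<phi>' M' N' f g X \<in> carrier (tensor K' \<phi>' M' N')"
    and "\<lbrakk>X \<in> carrier (tensor K \<phi> M N); Y \<in> carrier (tensor K \<phi> M N)\<rbrakk> \<Longrightarrow>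
      tensor_map K' \<phi>' M' N' f g (X \<oplus>\<^bsub>tensor K \<phi> M N\<^esub> Y)
        = tensor_map K' \<phi>' M' N' f g X \<oplus>\<^bsub>tensor K' \<phi>' M' N'\<^esub> tensor_map K' \<phi>' M' N' f g Y"
    and "\<lbrakk>x \<in> carrier M; y \<in> carrier N\<rbrakk> \<Longrightarrow>
      tensor_map K' \<phi>' M' N' f g (pure_tensor K \<phi> M N x y) = pure_tensor K' \<phi>' M' N' (f x) (g y)"
  using map_hom[OF assms] by (simp_all add: add_hom_closed add_hom_add)

section \<open>Triple tensor products and associativity\<close>

locale tensor_product3 =
  MN: tensor_product L A Q M N K \<phi> + NP: tensor_product A Q U N P J \<psi>
  for L :: "('l, 'v) ring_scheme" and A :: "('a, 'w) ring_scheme" and Q :: "('q, 'x) ring_scheme"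
    and U :: "('u, 'z) ring_scheme"
    and M :: "('l, 'a, 'm) bimod" and N :: "('a, 'q, 'n) bimod" and P :: "('q, 'u, 'p) bimod"
    and K :: "('k, 'y) ring_scheme" and \<phi> :: "'k \<Rightarrow> 'a"
    and J :: "('j, 'i) ring_scheme" and \<psi> :: "'j \<Rightarrow> 'q"
begin

sublocale MN_P: tensor_product L Q U "tensor K \<phi> M N" P J \<psi>
  by unfold_locales (rule NP.scalars)

sublocale M_NP: tensor_product L A U M "tensor J \<psi> N P" K \<phi>
  by unfold_locales (rule MN.scalars)

text \<open>A map of three variables is lifted in two stages. After the first lift, balance in the
  remaining pair is inherited by induction on \<open>X\<close>: for pure \<open>X\<close> it is the
  balance of \<open>F x\<close> in the last two variables.\<close>

lemma balanced_lift_left: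
  assumes G: "abelian_group G"
    and F: "\<And>z. z \<in> carrier P \<Longrightarrow> balanced K \<phi> M N G (\<lambda>x y. F x y z)"
    and F': "\<And>x. x \<in> carrier M \<Longrightarrow> balanced J \<psi> N P G (F x)"
  shows "balanced J \<psi> (tensor K \<phi> M N) P G (\<lambda>X z. tensor_lift G (\<lambda>x y. F x y z) X)"
proof -
  interpret G: abelian_group G by (rule G)
  note [simp] = MN.lift_hom_add_monoid[OF G F] MN.lift_pure[OF G F]
  note [simp] = balancedD[OF F']
  show ?thesis
  proof (rule balancedI)
    show "tensor_lift G (\<lambda>x y. F x y (z \<oplus>\<^bsub>P\<^esub> z')) X
        = tensor_lift G (\<lambda>x y. F x y z) X \<oplus>\<^bsub>G\<^esub> tensor_lift G (\<lambda>x y. F x y z') X"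
      if "X \<in> carrier (tensor K \<phi> M N)" "z \<in> carrier P" "z' \<in> carrier P" for X z z'
      using that by (induction X rule: MN.tensor_induct) (simp_all add: G.a_ac)
    show "tensor_lift G (\<lambda>x y. F x y z) (X \<triangleleft>\<^bsub>tensor K \<phi> M N\<^esub> \<psi> j)
        = tensor_lift G (\<lambda>x y. F x y (\<psi> j \<triangleright>\<^bsub>P\<^esub> z)) X"
      if "X \<in> carrier (tensor K \<phi> M N)" "j \<in> carrier J" "z \<in> carrier P" for X j z
      using that by (induction X rule: MN.tensor_induct) (simp_all add: NP.scalars)
  qed simp_all
qed

lemma balanced_lift_right:
  assumes G: "abelian_group G"
    and F: "\<And>z. z \<in> carrier P \<Longrightarrow> balanced K \<phi> M N G (\<lambda>x y. F x y z)"
    and F': "\<And>x. x \<in> carrier M \<Longrightarrow> balanced J \<psi> N P G (F x)"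
  shows "balanced K \<phi> M (tensor J \<psi> N P) G (\<lambda>x. tensor_lift G (F x))"
proof -
  interpret G: abelian_group G by (rule G)
  note [simp] = NP.lift_hom_add_monoid[OF G F'] NP.lift_pure[OF G F']
  note [simp] = balancedD[OF F]
  show ?thesis
  proof (rule balancedI)
    show "tensor_lift G (F (x \<oplus>\<^bsub>M\<^esub> x')) X = tensor_lift G (F x) X \<oplus>\<^bsub>G\<^esub> tensor_lift G (F x') X"
      if "x \<in> carrier M" "x' \<in> carrier M" "X \<in> carrier (tensor J \<psi> N P)" for X x x'
      using that(3,1,2) by (induction X rule: NP.tensor_induct) (simp_all add: G.a_ac)
    show "tensor_lift G (F (x \<triangleleft>\<^bsub>M\<^esub> \<phi> k)) X = tensor_lift G (F x) (\<phi> k \<triangleright>\<^bsub>tensor J \<psi> N P\<^esub> X)"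
      if "x \<in> carrier M" "k \<in> carrier K" "X \<in> carrier (tensor J \<psi> N P)" for X k x
      using that(3,1,2) by (induction X rule: NP.tensor_induct) (simp_all add: MN.scalars)
  qed simp_all
qed

text \<open>The flipped rule pulls a scalar out of the inner pure tensor, where it can cross the
  outer one.\<close>

lemma assoc_balanced:
  "z \<in> carrier P \<Longrightarrow> balanced K \<phi> M N (tensor K \<phi> M (tensor J \<psi> N P))
     (\<lambda>x y. pure_tensor K \<phi> M (tensor J \<psi> N P) x (pure_tensor J \<psi> N P y z))"
  "x \<in> carrier M \<Longrightarrow> balanced J \<psi> N P (tensor K \<phi> M (tensor J \<psi> N P))
     (\<lambda>y z. pure_tensor K \<phi> M (tensor J \<psi> N P) x (pure_tensor J \<psi> N P y z))"
  by (rule balancedI;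
      simp add: MN.scalars M_NP.pure_balanced NP.pure_balanced flip: NP.lact_pure)+

lemma assoc_inv_balanced:
  "z \<in> carrier P \<Longrightarrow> balanced K \<phi> M N (tensor J \<psi> (tensor K \<phi> M N) P)
     (\<lambda>x y. pure_tensor J \<psi> (tensor K \<phi> M N) P (pure_tensor K \<phi> M N x y) z)"
  "x \<in> carrier M \<Longrightarrow> balanced J \<psi> N P (tensor J \<psi> (tensor K \<phi> M N) P)
     (\<lambda>y z. pure_tensor J \<psi> (tensor K \<phi> M N) P (pure_tensor K \<phi> M N x y) z)"
  by (rule balancedI;
      simp add: NP.scalars MN_P.pure_balanced MN.pure_balanced flip: MN.ract_pure)+

lemma assoc_hom:
  "tensor_assoc K \<phi> J \<psi> M N P
    \<in> add_hom (tensor J \<psi> (tensor K \<phi> M N) P) (tensor K \<phi> M (tensor J \<psi> N P))"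
  unfolding tensor_assoc_def Let_def
  by (rule MN_P.lift_hom[OF M_NP.tensor_abelian balanced_lift_left[OF M_NP.tensor_abelian assoc_balanced]])

lemma assoc_pure [simp]:
  assumes "x \<in> carrier M" "y \<in> carrier N" "z \<in> carrier P"
  shows "tensor_assoc K \<phi> J \<psi> M N P (pure_tensor J \<psi> (tensor K \<phi> M N) P (pure_tensor K \<phi> M N x y) z)
    = pure_tensor K \<phi> M (tensor J \<psi> N P) x (pure_tensor J \<psi> N P y z)"
  unfolding tensor_assoc_def Let_def
  using assms
  by (simp add: MN_P.lift_pure[OF M_NP.tensor_abelian balanced_lift_left[OF M_NP.tensor_abelian assoc_balanced]]
    MN.lift_pure[OF M_NP.tensor_abelian assoc_balanced(1)])

lemma assoc_inv_hom:
  "tensor_assoc_inv K \<phi> J \<psi> M N P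
    \<in> add_hom (tensor K \<phi> M (tensor J \<psi> N P)) (tensor J \<psi> (tensor K \<phi> M N) P)"
  unfolding tensor_assoc_inv_def Let_def
  by (rule M_NP.lift_hom[OF MN_P.tensor_abelian balanced_lift_right[OF MN_P.tensor_abelian assoc_inv_balanced]])

lemma assoc_inv_pure [simp]:
  assumes "x \<in> carrier M" "y \<in> carrier N" "z \<in> carrier P"
  shows "tensor_assoc_inv K \<phi> J \<psi> M N P (pure_tensor K \<phi> M (tensor J \<psi> N P) x (pure_tensor J \<psi> N P y z))
    = pure_tensor J \<psi> (tensor K \<phi> M N) P (pure_tensor K \<phi> M N x y) z"
  unfolding tensor_assoc_inv_def Let_def
  using assms
  by (simp add: M_NP.lift_pure[OF MN_P.tensor_abelian balanced_lift_right[OF MN_P.tensor_abelian assoc_inv_balanced]]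
    NP.lift_pure[OF MN_P.tensor_abelian assoc_inv_balanced(2)])

lemmas assoc_simps [simp] = add_hom_closed[OF assoc_hom] add_hom_add[OF assoc_hom]
  add_hom_closed[OF assoc_inv_hom] add_hom_add[OF assoc_inv_hom]

text \<open>A pure tensor whose second entry is a sum is itself a sum of tensors, so pure triples
  already generate; the second induction runs inside the pure case of the first.\<close>

lemma M_NP_induct [consumes 1, case_names pure add]:
  assumes X: "X \<in> carrier (tensor K \<phi> M (tensor J \<psi> N P))"
    and pure: "\<And>x y z. \<lbrakk>x \<in> carrier M; y \<in> carrier N; z \<in> carrier P\<rbrakk>
      \<Longrightarrow> R (pure_tensor K \<phi> M (tensor J \<psi> N P) x (pure_tensor J \<psi> N P y z))"
    and add: "\<And>X Y. \<lbrakk>X \<in> carrier (tensor K \<phi> M (tensor J \<psi> N P));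
        Y \<in> carrier (tensor K \<phi> M (tensor J \<psi> N P)); R X; R Y\<rbrakk>
      \<Longrightarrow> R (X \<oplus>\<^bsub>tensor K \<phi> M (tensor J \<psi> N P)\<^esub> Y)"
  shows "R X"
  using X
proof (induction X rule: M_NP.tensor_induct)
  case (pure x Y)
  show ?case
    using pure(2,1) by (induction Y rule: NP.tensor_induct) (simp_all add: assms)
qed (rule add)

lemma MN_P_induct [consumes 1, case_names pure add]:
  assumes X: "X \<in> carrier (tensor J \<psi> (tensor K \<phi> M N) P)"
    and pure: "\<And>x y z. \<lbrakk>x \<in> carrier M; y \<in> carrier N; z \<in> carrier P\<rbrakk>
      \<Longrightarrow> R (pure_tensor J \<psi> (tensor K \<phi> M N) P (pure_tensor K \<phi> M N x y) z)"
    and add: "\<And>X Y. \<lbrakk>X \<in> carrier (tensor J \<psi> (tensor K \<phi> M N) P);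
        Y \<in> carrier (tensor J \<psi> (tensor K \<phi> M N) P); R X; R Y\<rbrakk>
      \<Longrightarrow> R (X \<oplus>\<^bsub>tensor J \<psi> (tensor K \<phi> M N) P\<^esub> Y)"
  shows "R X"
  using X
proof (induction X rule: MN_P.tensor_induct)
  case (pure Y z)
  show ?case
    using pure(1,2) by (induction Y rule: MN.tensor_induct) (simp_all add: assms)
qed (rule add)

lemma assoc_lact [simp]:
  "\<lbrakk>X \<in> carrier (tensor J \<psi> (tensor K \<phi> M N) P); a \<in> carrier L\<rbrakk> \<Longrightarrow>
    tensor_assoc K \<phi> J \<psi> M N P (a \<triangleright>\<^bsub>tensor J \<psi> (tensor K \<phi> M N) P\<^esub> X)
      = a \<triangleright>\<^bsub>tensor K \<phi> M (tensor J \<psi> N P)\<^esub> tensor_assoc K \<phi> J \<psi> M N P X"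
  by (induction X rule: MN_P_induct) simp_all

end

section \<open>Regular bimodules and duals\<close>

lemma regular_simps [simp]:
  "carrier (regular A) = carrier A" "add (regular A) = add A" "\<zero>\<^bsub>regular A\<^esub> = \<zero>\<^bsub>A\<^esub>"
  "lact (regular A) = monoid.mult A" "ract (regular A) = monoid.mult A"
  by (simp_all add: regular_def)

lemma (in ring) regular_bimodule: "bimodule R R (regular R)"
proof -
  have "abelian_group (regular R)"
    by (rule abelian_group_cong[OF abelian_group_axioms]) simp_all
  then show ?thesis
    by (auto intro!: bimodule.intro left_module.intro right_module.intro bimodule_axioms.intro
      left_module_axioms.intro right_module_axioms.intro ring_axioms simp: l_distr r_distr m_assoc)
qed

lemma restrict_scalars_simps [simp]:
  "carrier (restrict_scalars \<phi> \<psi> M) = carrier M" "add (restrict_scalars \<phi> \<psi> M) = add M"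
  "lact (restrict_scalars \<phi> \<psi> M) s x = lact M (\<phi> s) x"
  "ract (restrict_scalars \<phi> \<psi> M) x q = ract M x (\<psi> q)"
  by (simp_all add: restrict_scalars_def)

lemma bimod_homI:
  assumes "f \<in> add_hom M N"
    and "\<And>a x. \<lbrakk>a \<in> carrier L; x \<in> carrier M\<rbrakk> \<Longrightarrow> f (a \<triangleright>\<^bsub>M\<^esub> x) = a \<triangleright>\<^bsub>N\<^esub> f x"
    and "\<And>a x. \<lbrakk>a \<in> carrier Q; x \<in> carrier M\<rbrakk> \<Longrightarrow> f (x \<triangleleft>\<^bsub>M\<^esub> a) = f x \<triangleleft>\<^bsub>N\<^esub> a"
  shows "f \<in> bimod_hom L Q M N"
  using assms by (auto simp: bimod_hom_def left_hom_def right_hom_def)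

lemma bimod_homD:
  assumes "f \<in> bimod_hom L Q M N"
  shows "f \<in> add_hom M N"
    and "\<And>a x. \<lbrakk>a \<in> carrier L; x \<in> carrier M\<rbrakk> \<Longrightarrow> f (a \<triangleright>\<^bsub>M\<^esub> x) = a \<triangleright>\<^bsub>N\<^esub> f x"
    and "\<And>a x. \<lbrakk>a \<in> carrier Q; x \<in> carrier M\<rbrakk> \<Longrightarrow> f (x \<triangleleft>\<^bsub>M\<^esub> a) = f x \<triangleleft>\<^bsub>N\<^esub> a"
  using assms by (auto simp: bimod_hom_def left_hom_def right_hom_def)

lemma bimod_hom_simps:
  assumes "f \<in> bimod_hom L Q M N"
  shows "x \<in> carrier M \<Longrightarrow> f x \<in> carrier N"
    and "\<lbrakk>x \<in> carrier M; y \<in> carrier M\<rbrakk> \<Longrightarrow> f (x \<oplus>\<^bsub>M\<^esub> y) = f x \<oplus>\<^bsub>N\<^esub> f y"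
    and "\<lbrakk>a \<in> carrier L; x \<in> carrier M\<rbrakk> \<Longrightarrow> f (a \<triangleright>\<^bsub>M\<^esub> x) = a \<triangleright>\<^bsub>N\<^esub> f x"
    and "\<lbrakk>b \<in> carrier Q; x \<in> carrier M\<rbrakk> \<Longrightarrow> f (x \<triangleleft>\<^bsub>M\<^esub> b) = f x \<triangleleft>\<^bsub>N\<^esub> b"
  using bimod_homD[OF assms] by (simp_all add: add_hom_closed add_hom_add)

section \<open>Bimodule structure of the two duals\<close>

context bimodule
begin

lemma right_dual_carrier:
  "f \<in> carrier (right_dual Q M) \<longleftrightarrow> f \<in> extensional (carrier M) \<and>
     (\<forall>x\<in>carrier M. f x \<in> carrier Q) \<and>
     (\<forall>x\<in>carrier M. \<forall>y\<in>carrier M. f (x \<oplus>\<^bsub>M\<^esub> y) = f x \<oplus>\<^bsub>Q\<^esub> f y) \<and>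
     (\<forall>x\<in>carrier M. \<forall>a\<in>carrier Q. f (x \<triangleleft>\<^bsub>M\<^esub> a) = f x \<otimes>\<^bsub>Q\<^esub> a)"
  by (auto simp: right_dual_def right_hom_def add_hom_def)

lemma right_dual_ops:
  "\<zero>\<^bsub>right_dual Q M\<^esub> = (\<lambda>x\<in>carrier M. \<zero>\<^bsub>Q\<^esub>)"
  "f \<oplus>\<^bsub>right_dual Q M\<^esub> g = (\<lambda>x\<in>carrier M. f x \<oplus>\<^bsub>Q\<^esub> g x)"
  "a \<triangleright>\<^bsub>right_dual Q M\<^esub> f = (\<lambda>x\<in>carrier M. a \<otimes>\<^bsub>Q\<^esub> f x)"
  "f \<triangleleft>\<^bsub>right_dual Q M\<^esub> b = (\<lambda>x\<in>carrier M. f (b \<triangleright>\<^bsub>M\<^esub> x))"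
  by (simp_all add: right_dual_def)

lemma left_dual_carrier:
  "f \<in> carrier (left_dual L M) \<longleftrightarrow> f \<in> extensional (carrier M) \<and>
     (\<forall>x\<in>carrier M. f x \<in> carrier L) \<and>
     (\<forall>x\<in>carrier M. \<forall>y\<in>carrier M. f (x \<oplus>\<^bsub>M\<^esub> y) = f x \<oplus>\<^bsub>L\<^esub> f y) \<and>
     (\<forall>x\<in>carrier M. \<forall>a\<in>carrier L. f (a \<triangleright>\<^bsub>M\<^esub> x) = a \<otimes>\<^bsub>L\<^esub> f x)"
  by (auto simp: left_dual_def left_hom_def add_hom_def)

lemma left_dual_ops:
  "\<zero>\<^bsub>left_dual L M\<^esub> = (\<lambda>x\<in>carrier M. \<zero>\<^bsub>L\<^esub>)"
  "f \<oplus>\<^bsub>left_dual L M\<^esub> g = (\<lambda>x\<in>carrier M. f x \<oplus>\<^bsub>L\<^esub> g x)"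
  "a \<triangleright>\<^bsub>left_dual L M\<^esub> f = (\<lambda>x\<in>carrier M. f (x \<triangleleft>\<^bsub>M\<^esub> a))"
  "f \<triangleleft>\<^bsub>left_dual L M\<^esub> b = (\<lambda>x\<in>carrier M. f x \<otimes>\<^bsub>L\<^esub> b)"
  by (simp_all add: left_dual_def)

lemma right_dual_closed: "\<lbrakk>f \<in> carrier (right_dual Q M); x \<in> carrier M\<rbrakk> \<Longrightarrow> f x \<in> carrier Q"
  by (simp add: right_dual_carrier)

lemma left_dual_closed: "\<lbrakk>f \<in> carrier (left_dual L M); x \<in> carrier M\<rbrakk> \<Longrightarrow> f x \<in> carrier L"
  by (simp add: left_dual_carrier)

lemma right_dual_apply:
  assumes "x \<in> carrier M"
  shows "(f \<oplus>\<^bsub>right_dual Q M\<^esub> g) x = f x \<oplus>\<^bsub>Q\<^esub> g x"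
    and "(a \<triangleright>\<^bsub>right_dual Q M\<^esub> f) x = a \<otimes>\<^bsub>Q\<^esub> f x"
    and "(f \<triangleleft>\<^bsub>right_dual Q M\<^esub> b) x = f (b \<triangleright>\<^bsub>M\<^esub> x)"
  using assms by (simp_all add: right_dual_ops)

lemma left_dual_apply:
  assumes "x \<in> carrier M"
  shows "(f \<oplus>\<^bsub>left_dual L M\<^esub> g) x = f x \<oplus>\<^bsub>L\<^esub> g x"
    and "(a \<triangleright>\<^bsub>left_dual L M\<^esub> f) x = f (x \<triangleleft>\<^bsub>M\<^esub> a)"
    and "(f \<triangleleft>\<^bsub>left_dual L M\<^esub> b) x = f x \<otimes>\<^bsub>L\<^esub> b"
  using assms by (simp_all add: left_dual_ops)

text \<open>The sides are exchanged: \<open>Q\<close> acts on values and \<open>L\<close> on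
  arguments, and precomposition turns the left action of \<open>L\<close> on \<open>M\<close> into a
  right action. All operations are restricted to the carrier, so each law reduces to its pointwise
  form.\<close>

lemma right_dual_bimodule: "bimodule Q L (right_dual Q M)"
proof -
  note [simp] = L.ring_axioms Q.ring_axioms
  have "abelian_group (right_dual Q M)"
  proof (rule abelian_groupI)
    show "\<exists>g\<in>carrier (right_dual Q M). g \<oplus>\<^bsub>right_dual Q M\<^esub> f = \<zero>\<^bsub>right_dual Q M\<^esub>"
      if "f \<in> carrier (right_dual Q M)" for f
      using that
      by (intro bexI[of _ "\<lambda>x\<in>carrier M. \<ominus>\<^bsub>Q\<^esub> f x"])
         (auto simp: right_dual_carrier right_dual_ops Q.minus_add Q.l_minus Q.l_neg intro!: restrict_ext)
  qed (auto simp: right_dual_carrier right_dual_ops Q.add.m_ac Q.l_distr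
        intro!: restrict_ext extensionalityI[of _ "carrier M"])
  then show ?thesis
    by (intro bimodule.intro left_module.intro right_module.intro bimodule_axioms.intro
      left_module_axioms.intro right_module_axioms.intro)
      (auto simp: right_dual_carrier right_dual_ops Q.add.m_ac Q.l_distr Q.r_distr Q.m_assoc
        lact_ract [symmetric] add_lact mult_lact
        intro!: restrict_ext extensionalityI[of _ "carrier M"])
qed

lemma left_dual_bimodule: "bimodule Q L (left_dual L M)"
proof -
  note [simp] = L.ring_axioms Q.ring_axioms
  have "abelian_group (left_dual L M)"
  proof (rule abelian_groupI)
    show "\<exists>g\<in>carrier (left_dual L M). g \<oplus>\<^bsub>left_dual L M\<^esub> f = \<zero>\<^bsub>left_dual L M\<^esub>"
      if "f \<in> carrier (left_dual L M)" for f
      using that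
      by (intro bexI[of _ "\<lambda>x\<in>carrier M. \<ominus>\<^bsub>L\<^esub> f x"])
         (auto simp: left_dual_carrier left_dual_ops L.minus_add L.r_minus L.l_neg intro!: restrict_ext)
  qed (auto simp: left_dual_carrier left_dual_ops L.add.m_ac L.r_distr
        intro!: restrict_ext extensionalityI[of _ "carrier M"])
  then show ?thesis
    by (intro bimodule.intro left_module.intro right_module.intro bimodule_axioms.intro
      left_module_axioms.intro right_module_axioms.intro)
      (auto simp: left_dual_carrier left_dual_ops L.add.m_ac L.l_distr L.r_distr L.m_assoc
        lact_ract add_ract mult_ract
        intro!: restrict_ext extensionalityI[of _ "carrier M"])
qed

end

section \<open>The \<open>A\<close>-coring\<close>

context formal_dual
begin

abbreviation "CA \<equiv> tensor S \<beta> That T"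
abbreviation "DB \<equiv> tensor R \<alpha> T That"
abbreviation "W \<equiv> tensor R \<alpha> T CA"
abbreviation "pC \<equiv> pure_tensor S \<beta> That T"
abbreviation "pD \<equiv> pure_tensor R \<alpha> T That"
abbreviation "pW \<equiv> pure_tensor R \<alpha> T CA"

sublocale regA: bimodule A A "regular A"
  by (rule alpha.S.regular_bimodule)

sublocale regB: bimodule B B "regular B"
  by (rule beta.S.regular_bimodule)

sublocale CA: tensor_product A B A That T S \<beta>
  by unfold_locales simp

sublocale DB: tensor_product B A B T That R \<alpha>
  by unfold_locales simp

sublocale TThT: tensor_product3 B A B A T That T R \<alpha> S \<beta>
  by unfold_locales

sublocale BT: tensor_product B B A "regular B" T S \<beta>
  by unfold_locales simp

sublocale TA: tensor_product B A A T "regular A" R \<alpha>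
  by unfold_locales simp

lemmas ev_simps [simp] = bimod_hom_simps[OF ev_hom, unfolded regular_simps]
lemmas evh_simps [simp] = bimod_hom_simps[OF evh_hom, unfolded regular_simps]

text \<open>The left side of the first normalisation axiom, with \<open>\<gamma> x\<close> replaced
  by an arbitrary \<open>w\<close>. Identities about \<open>\<gamma> x\<close> are proved for all
  \<open>w\<close> in \<open>W\<close> by induction on pure tensors and specialised
  afterwards.\<close>

definition evh_T where
  "evh_T w = tensor_map S \<beta> (regular B) T evh id (tensor_assoc_inv R \<alpha> S \<beta> T That T w)"

lemma evh_T_simps [simp]:
  "w \<in> carrier W \<Longrightarrow> evh_T w \<in> carrier (tensor S \<beta> (regular B) T)"
  "\<lbrakk>v \<in> carrier W; w \<in> carrier W\<rbrakk>
    \<Longrightarrow> evh_T (v \<oplus>\<^bsub>W\<^esub> w) = evh_T v \<oplus>\<^bsub>tensor S \<beta> (regular B) T\<^esub> evh_T w"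
  "\<lbrakk>x \<in> carrier T; u \<in> carrier That; y \<in> carrier T\<rbrakk>
    \<Longrightarrow> evh_T (pW x (pC u y)) = pure_tensor S \<beta> (regular B) T (evh (pD x u)) y"
proof -
  have evh: "evh \<in> add_hom DB (regular B)" by (rule bimod_homD[OF evh_hom])
  have bal: "pure_tensor S \<beta> (regular B) T (evh (z \<triangleleft>\<^bsub>DB\<^esub> \<beta> k)) (id y)
      = pure_tensor S \<beta> (regular B) T (evh z) (id (\<beta> k \<triangleright>\<^bsub>T\<^esub> y))"
    if "z \<in> carrier DB" "k \<in> carrier S" "y \<in> carrier T" for z k y
    using that BT.pure_balanced[of "evh z" k y] by simp
  note [simp] = TThT.MN_P.map_simps[where f = evh and g = id, OF BT.tensor_product_axioms evh id_add_hom bal]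
  show "w \<in> carrier W \<Longrightarrow> evh_T w \<in> carrier (tensor S \<beta> (regular B) T)"
    "\<lbrakk>v \<in> carrier W; w \<in> carrier W\<rbrakk>
      \<Longrightarrow> evh_T (v \<oplus>\<^bsub>W\<^esub> w) = evh_T v \<oplus>\<^bsub>tensor S \<beta> (regular B) T\<^esub> evh_T w"
    "\<lbrakk>x \<in> carrier T; u \<in> carrier That; y \<in> carrier T\<rbrakk>
      \<Longrightarrow> evh_T (pW x (pC u y)) = pure_tensor S \<beta> (regular B) T (evh (pD x u)) y"
    by (simp_all add: evh_T_def)
qed

text \<open>Only the last factor carries the right action, and \<open>evh\<close> does not touch it.
  This is what later yields right linearity of \<open>gamma_A\<close> over all of
  \<open>A\<close>.\<close>

lemma evh_T_ract [simp]:
  "\<lbrakk>w \<in> carrier W; a \<in> carrier A\<rbrakk>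
    \<Longrightarrow> evh_T (w \<triangleleft>\<^bsub>W\<^esub> a) = evh_T w \<triangleleft>\<^bsub>tensor S \<beta> (regular B) T\<^esub> a"
  by (induction w rule: TThT.M_NP_induct) simp_all

text \<open>The same device for the second normalisation axiom.\<close>

definition T_ev where
  "T_ev = tensor_map R \<alpha> T (regular A) id ev"

lemma T_ev_simps [simp]:
  "w \<in> carrier W \<Longrightarrow> T_ev w \<in> carrier (tensor R \<alpha> T (regular A))"
  "\<lbrakk>v \<in> carrier W; w \<in> carrier W\<rbrakk>
    \<Longrightarrow> T_ev (v \<oplus>\<^bsub>W\<^esub> w) = T_ev v \<oplus>\<^bsub>tensor R \<alpha> T (regular A)\<^esub> T_ev w"
  "\<lbrakk>x \<in> carrier T; c \<in> carrier CA\<rbrakk>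
    \<Longrightarrow> T_ev (pW x c) = pure_tensor R \<alpha> T (regular A) x (ev c)"
proof -
  have ev: "ev \<in> add_hom CA (regular A)" by (rule bimod_homD[OF ev_hom])
  have bal: "pure_tensor R \<alpha> T (regular A) (id (x \<triangleleft>\<^bsub>T\<^esub> \<alpha> k)) (ev c)
      = pure_tensor R \<alpha> T (regular A) (id x) (ev (\<alpha> k \<triangleright>\<^bsub>CA\<^esub> c))"
    if "x \<in> carrier T" "k \<in> carrier R" "c \<in> carrier CA" for x k c
    using that TA.pure_balanced[of x k "ev c"] by simp
  note [simp] = TThT.M_NP.map_simps[where f = id and g = ev, OF TA.tensor_product_axioms id_add_hom ev bal]
  show "w \<in> carrier W \<Longrightarrow> T_ev w \<in> carrier (tensor R \<alpha> T (regular A))"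
    "\<lbrakk>v \<in> carrier W; w \<in> carrier W\<rbrakk>
      \<Longrightarrow> T_ev (v \<oplus>\<^bsub>W\<^esub> w) = T_ev v \<oplus>\<^bsub>tensor R \<alpha> T (regular A)\<^esub> T_ev w"
    "\<lbrakk>x \<in> carrier T; c \<in> carrier CA\<rbrakk>
      \<Longrightarrow> T_ev (pW x c) = pure_tensor R \<alpha> T (regular A) x (ev c)"
    by (simp_all add: T_ev_def)
qed

lemma T_ev_lact [simp]:
  "\<lbrakk>w \<in> carrier W; b \<in> carrier B\<rbrakk>
    \<Longrightarrow> T_ev (b \<triangleright>\<^bsub>W\<^esub> w) = b \<triangleright>\<^bsub>tensor R \<alpha> T (regular A)\<^esub> T_ev w"
  by (induction w rule: TThT.M_NP_induct) simp_all

end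

context bimodule_herd
begin

lemmas gamma_simps [simp] = bimod_hom_simps[OF shepherd_hom, unfolded restrict_scalars_simps]

lemma gamma_add_hom: "\<gamma> \<in> add_hom T W"
  by (rule add_homI) simp_all

lemma evh_T_gamma [simp]:
  "x \<in> carrier T \<Longrightarrow> evh_T (\<gamma> x) = pure_tensor S \<beta> (regular B) T \<one>\<^bsub>B\<^esub> x"
  using shepherd_evh by (simp add: evh_T_def)

lemma T_ev_gamma [simp]:
  "x \<in> carrier T \<Longrightarrow> T_ev (\<gamma> x) = pure_tensor R \<alpha> T (regular A) x \<one>\<^bsub>A\<^esub>"
  using shepherd_ev by (simp add: T_ev_def)

end

context bimodule_herd
begin

abbreviation "TC \<equiv> tensor A id T CA"
abbreviation "CC \<equiv> tensor A id CA CA"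
abbreviation "pTC \<equiv> pure_tensor A id T CA"
abbreviation "pCC \<equiv> pure_tensor A id CA CA"
abbreviation "ThW \<equiv> tensor S \<beta> That W"

interpretation CC: tensor_product A A A CA CA A id
  by unfold_locales simp

interpretation TC: tensor_product B A A T CA A id
  by unfold_locales simp

interpretation TCC: tensor_product3 B A A A T CA CA A id A id
  by unfold_locales

interpretation CCC: tensor_product3 A A A A CA CA CA A id A id
  by unfold_locales

interpretation ThTC: tensor_product3 A B A A That T CA S \<beta> A id
  by unfold_locales

interpretation TCC_R: tensor_product3 B A A A T CA CA R \<alpha> R \<alpha>
  by unfold_locales simp

interpretation ThTC_R: tensor_product3 A B A A That T CA S \<beta> R \<alpha>
  by unfold_locales

interpretation TThW: tensor_product3 B A B A T That W R \<alpha> S \<beta>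
  by unfold_locales

interpretation RD: bimodule A B "right_dual A T"
  by (rule T.right_dual_bimodule)

interpretation RDT: tensor_product A B A "right_dual A T" T S \<beta>
  by unfold_locales simp

text \<open>As rewrite rules these always move a scalar from the left entry to the right one, which
  gives tensors over \<open>A\<close> a normal form.\<close>

lemmas middle_A [simp] =
  TC.tensor_product_axioms [THEN tensor_product_middle] CC.tensor_product_axioms [THEN tensor_product_middle]
  TCC.MN_P.tensor_product_axioms [THEN tensor_product_middle]
  TCC.M_NP.tensor_product_axioms [THEN tensor_product_middle]
  CCC.MN_P.tensor_product_axioms [THEN tensor_product_middle]
  CCC.M_NP.tensor_product_axioms [THEN tensor_product_middle]

lemmas middle_R [simp] =
  TThW.M_NP.pure_balanced TCC_R.MN_P.pure_balanced TCC_R.M_NP.pure_balanced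

section \<open>The right coaction over A\<close>

definition "proj_A = tensor_map A id T CA id id"

lemma proj_A_simps [simp]:
  "w \<in> carrier W \<Longrightarrow> proj_A w \<in> carrier TC"
  "\<lbrakk>v \<in> carrier W; w \<in> carrier W\<rbrakk> \<Longrightarrow> proj_A (v \<oplus>\<^bsub>W\<^esub> w) = proj_A v \<oplus>\<^bsub>TC\<^esub> proj_A w"
  "\<lbrakk>x \<in> carrier T; c \<in> carrier CA\<rbrakk> \<Longrightarrow> proj_A (pW x c) = pTC x c"
  by (simp_all add: proj_A_def
    TThT.M_NP.map_simps[where f = id and g = id, OF TC.tensor_product_axioms id_add_hom id_add_hom])

lemma proj_A_act [simp]:
  "\<lbrakk>w \<in> carrier W; b \<in> carrier B\<rbrakk> \<Longrightarrow> proj_A (b \<triangleright>\<^bsub>W\<^esub> w) = b \<triangleright>\<^bsub>TC\<^esub> proj_A w"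
  "\<lbrakk>w \<in> carrier W; a \<in> carrier A\<rbrakk> \<Longrightarrow> proj_A (w \<triangleleft>\<^bsub>W\<^esub> a) = proj_A w \<triangleleft>\<^bsub>TC\<^esub> a"
  by (induction w rule: TThT.M_NP_induct) simp_all

definition "gamma_A = shepherd_A S A \<beta> T That \<gamma>"

lemma gamma_A_proj: "gamma_A x = proj_A (\<gamma> x)"
  by (simp add: gamma_A_def shepherd_A_def proj_A_def)

lemma gamma_A_simps [simp]:
  "x \<in> carrier T \<Longrightarrow> gamma_A x \<in> carrier TC"
  "\<lbrakk>x \<in> carrier T; y \<in> carrier T\<rbrakk> \<Longrightarrow> gamma_A (x \<oplus>\<^bsub>T\<^esub> y) = gamma_A x \<oplus>\<^bsub>TC\<^esub> gamma_A y"
  "\<lbrakk>s \<in> carrier S; x \<in> carrier T\<rbrakk> \<Longrightarrow> gamma_A (\<beta> s \<triangleright>\<^bsub>T\<^esub> x) = \<beta> s \<triangleright>\<^bsub>TC\<^esub> gamma_A x"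
  by (simp_all add: gamma_A_proj)

lemma gamma_A_hom: "gamma_A \<in> add_hom T TC"
  by (rule add_homI) simp_all

text \<open>The canonical map from the pen to the right dual. The restriction makes its values
  extensional, as membership in \<open>right_dual A T\<close> demands.\<close>

definition ev_map where "ev_map u = (\<lambda>t\<in>carrier T. ev (pC u t))"

lemma ev_map_app [simp]: "t \<in> carrier T \<Longrightarrow> ev_map u t = ev (pC u t)"
  by (simp add: ev_map_def)

lemma ev_map_closed [simp]: "u \<in> carrier That \<Longrightarrow> ev_map u \<in> carrier (right_dual A T)"
  by (auto simp: T.right_dual_carrier ev_map_def simp flip: CA.ract_pure)

text \<open>Contracts the first leg with the functional \<open>f\<close>. Contracting
  \<open>\<gamma> x\<close> in this way is also the formula for the inverse of the isomorphism with
  the tensor product of the dual.\<close>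

definition contract_A where "contract_A f = tensor_lift CA (\<lambda>t c. f t \<triangleright>\<^bsub>CA\<^esub> c)"

lemma contract_A_simps [simp]:
  assumes f: "f \<in> carrier (right_dual A T)"
  shows "w \<in> carrier W \<Longrightarrow> contract_A f w \<in> carrier CA"
    and "\<lbrakk>v \<in> carrier W; w \<in> carrier W\<rbrakk> \<Longrightarrow> contract_A f (v \<oplus>\<^bsub>W\<^esub> w) = contract_A f v \<oplus>\<^bsub>CA\<^esub> contract_A f w"
    and "\<lbrakk>x \<in> carrier T; c \<in> carrier CA\<rbrakk> \<Longrightarrow> contract_A f (pW x c) = f x \<triangleright>\<^bsub>CA\<^esub> c"
proof -
  have "balanced R \<alpha> T CA CA (\<lambda>t c. f t \<triangleright>\<^bsub>CA\<^esub> c)"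
    using f by (intro balancedI)
      (simp_all add: T.right_dual_carrier CA.tensor.add_lact CA.tensor.mult_lact)
  note TThT.M_NP.lift_simps[OF CA.tensor_abelian this]
  then show "w \<in> carrier W \<Longrightarrow> contract_A f w \<in> carrier CA"
    "\<lbrakk>v \<in> carrier W; w \<in> carrier W\<rbrakk> \<Longrightarrow> contract_A f (v \<oplus>\<^bsub>W\<^esub> w) = contract_A f v \<oplus>\<^bsub>CA\<^esub> contract_A f w"
    "\<lbrakk>x \<in> carrier T; c \<in> carrier CA\<rbrakk> \<Longrightarrow> contract_A f (pW x c) = f x \<triangleright>\<^bsub>CA\<^esub> c"
    by (simp_all add: contract_A_def)
qed

text \<open>By \<open>ev_evh\<close>, contraction with \<open>ev_map u\<close> factors through
  \<open>evh_T\<close>, followed by b \<otimes> y \<mapsto> u b \<otimes> y. At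
  \<open>\<gamma> y\<close> the first normalisation axiom leaves 1 \<otimes> y.\<close>

lemma contract_A_gamma [simp]:
  assumes u: "u \<in> carrier That" and y: "y \<in> carrier T"
  shows "contract_A (ev_map u) (\<gamma> y) = pC u y"
proof -
  let ?J = "tensor_lift CA (\<lambda>b y. pC (u \<triangleleft>\<^bsub>That\<^esub> b) y)"
  have "balanced S \<beta> (regular B) T CA (\<lambda>b y. pC (u \<triangleleft>\<^bsub>That\<^esub> b) y)"
    using u by (intro balancedI) (simp_all add: That.add_ract That.mult_ract CA.pure_balanced)
  note [simp] = BT.lift_simps[OF CA.tensor_abelian this]
  have "contract_A (ev_map u) w = ?J (evh_T w)" if "w \<in> carrier W" for w
    using that u by (induction w rule: TThT.M_NP_induct) (simp_all add: ev_evh)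
  from this[of "\<gamma> y"] show ?thesis
    using u y by simp
qed

text \<open>On the first leg t of \<open>w\<close>, evh(x \<otimes> u) t = x ev(u \<otimes> t), and
  the scalar ev(u \<otimes> t) of \<open>A\<close> may cross the tensor sign because the target is
  formed over \<open>A\<close>. What remains on the right is the contraction with
  \<open>ev_map u\<close>.\<close>

lemma evh_gamma_A:
  assumes "x \<in> carrier T" "u \<in> carrier That" "y \<in> carrier T"
  shows "evh (pD x u) \<triangleright>\<^bsub>TC\<^esub> gamma_A y = pTC x (pC u y)"
proof -
  have "evh (pD x u) \<triangleright>\<^bsub>TC\<^esub> proj_A w = pTC x (contract_A (ev_map u) w)" if "w \<in> carrier W" for w
    using that assms(1,2)
    by (induction w rule: TThT.M_NP.tensor_induct) (simp_all add: evh_ev)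
  from this[of "\<gamma> y"] show ?thesis
    using assms by (simp add: gamma_A_proj)
qed

text \<open>Well defined on a tensor product over \<open>S\<close> because \<open>gamma_A\<close> is
  left linear over \<open>S\<close>, a property inherited from the shepherd.\<close>

definition act_gamma_A where "act_gamma_A = tensor_lift TC (\<lambda>b y. b \<triangleright>\<^bsub>TC\<^esub> gamma_A y)"

lemma act_gamma_A_simps [simp]:
  "X \<in> carrier (tensor S \<beta> (regular B) T) \<Longrightarrow> act_gamma_A X \<in> carrier TC"
  "\<lbrakk>X \<in> carrier (tensor S \<beta> (regular B) T); Y \<in> carrier (tensor S \<beta> (regular B) T)\<rbrakk>
    \<Longrightarrow> act_gamma_A (X \<oplus>\<^bsub>tensor S \<beta> (regular B) T\<^esub> Y) = act_gamma_A X \<oplus>\<^bsub>TC\<^esub> act_gamma_A Y"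
  "\<lbrakk>b \<in> carrier B; y \<in> carrier T\<rbrakk>
    \<Longrightarrow> act_gamma_A (pure_tensor S \<beta> (regular B) T b y) = b \<triangleright>\<^bsub>TC\<^esub> gamma_A y"
proof -
  have "balanced S \<beta> (regular B) T TC (\<lambda>b y. b \<triangleright>\<^bsub>TC\<^esub> gamma_A y)"
    by (rule balancedI) (simp_all add: TC.tensor.add_lact TC.tensor.mult_lact)
  note BT.lift_simps[OF TC.tensor_abelian this, folded act_gamma_A_def]
  then show "X \<in> carrier (tensor S \<beta> (regular B) T) \<Longrightarrow> act_gamma_A X \<in> carrier TC"
    "\<lbrakk>X \<in> carrier (tensor S \<beta> (regular B) T); Y \<in> carrier (tensor S \<beta> (regular B) T)\<rbrakk>
      \<Longrightarrow> act_gamma_A (X \<oplus>\<^bsub>tensor S \<beta> (regular B) T\<^esub> Y) = act_gamma_A X \<oplus>\<^bsub>TC\<^esub> act_gamma_A Y"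
    "\<lbrakk>b \<in> carrier B; y \<in> carrier T\<rbrakk>
      \<Longrightarrow> act_gamma_A (pure_tensor S \<beta> (regular B) T b y) = b \<triangleright>\<^bsub>TC\<^esub> gamma_A y"
    by simp_all
qed

lemma gamma_A_ract [simp]:
  assumes x: "x \<in> carrier T" and a: "a \<in> carrier A"
  shows "gamma_A (x \<triangleleft>\<^bsub>T\<^esub> a) = gamma_A x \<triangleleft>\<^bsub>TC\<^esub> a"
proof -
  \<comment> \<open>On pure triples this is \<open>evh_gamma_A\<close>. Hence
    \<open>proj_A w\<close> is determined by \<open>evh_T w\<close>.\<close>
  have G: "act_gamma_A (evh_T w) = proj_A w" if "w \<in> carrier W" for w
    using that by (induction w rule: TThT.M_NP_induct) (simp_all add: evh_gamma_A)
  have "gamma_A x \<triangleleft>\<^bsub>TC\<^esub> a = proj_A (\<gamma> x \<triangleleft>\<^bsub>W\<^esub> a)"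
    using x a by (simp add: gamma_A_proj)
  \<comment> \<open>\<open>evh_T_ract\<close> is withheld so that G applies. The next step uses it
    to bring the argument of \<open>act_gamma_A\<close> to 1 \<otimes> x a.\<close>
  also have "\<dots> = act_gamma_A (evh_T (\<gamma> x \<triangleleft>\<^bsub>W\<^esub> a))"
    using x a by (simp add: G del: evh_T_ract)
  also have "\<dots> = gamma_A (x \<triangleleft>\<^bsub>T\<^esub> a)"
    using x a by simp
  finally show ?thesis ..
qed

section \<open>The coproduct over A\<close>

definition extend_A where "extend_A u = tensor_map A id CA CA (pC u) id"

lemma extend_A_simps [simp]:
  assumes u: "u \<in> carrier That"
  shows "Y \<in> carrier TC \<Longrightarrow> extend_A u Y \<in> carrier CC"
    and "\<lbrakk>X \<in> carrier TC; Y \<in> carrier TC\<rbrakk> \<Longrightarrow> extend_A u (X \<oplus>\<^bsub>TC\<^esub> Y) = extend_A u X \<oplus>\<^bsub>CC\<^esub> extend_A u Y"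
    and "\<lbrakk>x \<in> carrier T; c \<in> carrier CA\<rbrakk> \<Longrightarrow> extend_A u (pTC x c) = pCC (pC u x) c"
  using u
  by (simp_all add: extend_A_def TC.map_simps[where f = "pC u" and g = id,
      OF CC.tensor_product_axioms CA.pure_right_hom id_add_hom] flip: CA.ract_pure)

text \<open>The first two laws make the formula for the coproduct balanced over \<open>S\<close>;
  the last two make it compatible with both actions of \<open>A\<close>.\<close>

lemma extend_A_linear [simp]:
  assumes Y: "Y \<in> carrier TC"
  shows "\<lbrakk>u \<in> carrier That; v \<in> carrier That\<rbrakk>
      \<Longrightarrow> extend_A (u \<oplus>\<^bsub>That\<^esub> v) Y = extend_A u Y \<oplus>\<^bsub>CC\<^esub> extend_A v Y"
    and "\<lbrakk>u \<in> carrier That; s \<in> carrier S\<rbrakk>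
      \<Longrightarrow> extend_A (u \<triangleleft>\<^bsub>That\<^esub> \<beta> s) Y = extend_A u (\<beta> s \<triangleright>\<^bsub>TC\<^esub> Y)"
    and "\<lbrakk>u \<in> carrier That; a \<in> carrier A\<rbrakk>
      \<Longrightarrow> extend_A (a \<triangleright>\<^bsub>That\<^esub> u) Y = a \<triangleright>\<^bsub>CC\<^esub> extend_A u Y"
    and "\<lbrakk>u \<in> carrier That; a \<in> carrier A\<rbrakk>
      \<Longrightarrow> extend_A u (Y \<triangleleft>\<^bsub>TC\<^esub> a) = extend_A u Y \<triangleleft>\<^bsub>CC\<^esub> a"
  using Y
  by (induction Y rule: TC.tensor_induct)
     (simp_all add: CC.a_ac CA.pure_balanced flip: CA.lact_pure)

text \<open>\<open>extend_A\<close> tensors with \<open>u\<close> on the left and rebrackets at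
  once, so values lie directly in \<open>CC\<close>. \<open>Delta_A_pure\<close> recovers the form
  with an explicit associativity isomorphism.\<close>

definition Delta_A where "Delta_A = tensor_lift CC (\<lambda>u x. extend_A u (gamma_A x))"

lemma Delta_A_simps [simp]:
  "c \<in> carrier CA \<Longrightarrow> Delta_A c \<in> carrier CC"
  "\<lbrakk>c \<in> carrier CA; d \<in> carrier CA\<rbrakk> \<Longrightarrow> Delta_A (c \<oplus>\<^bsub>CA\<^esub> d) = Delta_A c \<oplus>\<^bsub>CC\<^esub> Delta_A d"
  "\<lbrakk>u \<in> carrier That; x \<in> carrier T\<rbrakk> \<Longrightarrow> Delta_A (pC u x) = extend_A u (gamma_A x)"
proof -
  have "balanced S \<beta> That T CC (\<lambda>u x. extend_A u (gamma_A x))"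
    by (rule balancedI) simp_all
  note CA.lift_simps[OF CC.tensor_abelian this]
  then show "c \<in> carrier CA \<Longrightarrow> Delta_A c \<in> carrier CC"
    "\<lbrakk>c \<in> carrier CA; d \<in> carrier CA\<rbrakk> \<Longrightarrow> Delta_A (c \<oplus>\<^bsub>CA\<^esub> d) = Delta_A c \<oplus>\<^bsub>CC\<^esub> Delta_A d"
    "\<lbrakk>u \<in> carrier That; x \<in> carrier T\<rbrakk> \<Longrightarrow> Delta_A (pC u x) = extend_A u (gamma_A x)"
    by (simp_all add: Delta_A_def)
qed

lemma Delta_A_hom: "Delta_A \<in> add_hom CA CC"
  by (rule add_homI) simp_all

text \<open>Left linearity comes from the factor in the pen; right linearity rests on
  \<open>gamma_A_ract\<close>.\<close>

lemma Delta_A_act [simp]: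
  "\<lbrakk>c \<in> carrier CA; a \<in> carrier A\<rbrakk> \<Longrightarrow> Delta_A (a \<triangleright>\<^bsub>CA\<^esub> c) = a \<triangleright>\<^bsub>CC\<^esub> Delta_A c"
  "\<lbrakk>c \<in> carrier CA; a \<in> carrier A\<rbrakk> \<Longrightarrow> Delta_A (c \<triangleleft>\<^bsub>CA\<^esub> a) = Delta_A c \<triangleleft>\<^bsub>CC\<^esub> a"
  by (induction c rule: CA.tensor_induct) simp_all

lemma Delta_A_pure:
  assumes "u \<in> carrier That" "x \<in> carrier T"
  shows "Delta_A (pC u x) = tensor_assoc_inv S \<beta> A id That T CA (pure_tensor S \<beta> That TC u (gamma_A x))"
proof -
  have "extend_A u Y = tensor_assoc_inv S \<beta> A id That T CA (pure_tensor S \<beta> That TC u Y)"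
    if "Y \<in> carrier TC" for Y
    using that assms(1) by (induction Y rule: TC.tensor_induct) simp_all
  then show ?thesis
    using assms by simp
qed

section \<open>Counit laws over A\<close>

lemma coring_counit_left_A:
  assumes "c \<in> carrier CA"
  shows "tensor_lift CA (\<lambda>x y. ev x \<triangleright>\<^bsub>CA\<^esub> y) (Delta_A c) = c"
proof -
  have "balanced A id CA CA CA (\<lambda>x y. ev x \<triangleright>\<^bsub>CA\<^esub> y)"
    by (rule balancedI) (simp_all add: CA.tensor.add_lact CA.tensor.mult_lact)
  note E = CC.lift_simps[OF CA.tensor_abelian this]
  \<comment> \<open>Applying \<open>ev\<close> to the first factor after the extension by
    \<open>u\<close> is contraction with \<open>ev_map u\<close>, so \<open>contract_A_gamma\<close>
    finishes the argument.\<close>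
  have aux: "tensor_lift CA (\<lambda>x y. ev x \<triangleright>\<^bsub>CA\<^esub> y) (extend_A u (proj_A w)) = contract_A (ev_map u) w"
    if "w \<in> carrier W" "u \<in> carrier That" for w u
    using that by (induction w rule: TThT.M_NP.tensor_induct) (simp_all add: E)
  show ?thesis
    using assms by (induction c rule: CA.tensor_induct) (simp_all add: E aux gamma_A_proj)
qed

text \<open>The counit contraction after \<open>proj_A\<close> equals \<open>T_ev\<close> followed
  by the multiplication x \<otimes> a \<mapsto> x a; the second normalisation axiom makes this x 1 =
  x.\<close>

lemma comodule_counit_A:
  assumes x: "x \<in> carrier T"
  shows "tensor_lift T (\<lambda>x c. x \<triangleleft>\<^bsub>T\<^esub> ev c) (gamma_A x) = x"
proof -
  have "balanced A id T CA T (\<lambda>x c. x \<triangleleft>\<^bsub>T\<^esub> ev c)"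
    by (rule balancedI) (simp_all add: T.add_ract T.mult_ract)
  note E = TC.lift_simps[OF T.M.abelian_group_axioms this]
  have "balanced R \<alpha> T (regular A) T (ract T)"
    by (rule balancedI) (simp_all add: T.add_ract T.mult_ract)
  note m = TA.lift_simps[OF T.M.abelian_group_axioms this]
  have "tensor_lift T (\<lambda>x c. x \<triangleleft>\<^bsub>T\<^esub> ev c) (proj_A w) = tensor_lift T (ract T) (T_ev w)"
    if "w \<in> carrier W" for w
    using that by (induction w rule: TThT.M_NP.tensor_induct) (simp_all add: E m)
  from this[of "\<gamma> x"] show ?thesis
    using x by (simp add: gamma_A_proj m)
qed

text \<open>The counit acts away from the factor in the pen, so the law is the counit law of the
  comodule \<open>T\<close> tensored with \<open>u\<close>.\<close>

lemma coring_counit_right_A: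
  assumes "c \<in> carrier CA"
  shows "tensor_lift CA (\<lambda>x y. x \<triangleleft>\<^bsub>CA\<^esub> ev y) (Delta_A c) = c"
proof -
  have "balanced A id CA CA CA (\<lambda>x y. x \<triangleleft>\<^bsub>CA\<^esub> ev y)"
    by (rule balancedI) (simp_all add: CA.tensor.add_ract CA.tensor.mult_ract)
  note E = CC.lift_simps[OF CA.tensor_abelian this]
  have "balanced A id T CA T (\<lambda>x c. x \<triangleleft>\<^bsub>T\<^esub> ev c)"
    by (rule balancedI) (simp_all add: T.add_ract T.mult_ract)
  note E' = TC.lift_simps[OF T.M.abelian_group_axioms this]
  have aux: "tensor_lift CA (\<lambda>x y. x \<triangleleft>\<^bsub>CA\<^esub> ev y) (extend_A u Y)
      = pC u (tensor_lift T (\<lambda>x c. x \<triangleleft>\<^bsub>T\<^esub> ev c) Y)"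
    if "Y \<in> carrier TC" "u \<in> carrier That" for Y u
    using that by (induction Y rule: TC.tensor_induct) (simp_all add: E E')
  show ?thesis
    using assms by (induction c rule: CA.tensor_induct) (simp_all add: E aux comodule_counit_A)
qed

section \<open>Coassociativity over A\<close>

definition extend_W where "extend_W = tensor_lift CC (\<lambda>u w. extend_A u (proj_A w))"

lemma extend_W_simps [simp]:
  "z \<in> carrier ThW \<Longrightarrow> extend_W z \<in> carrier CC"
  "\<lbrakk>y \<in> carrier ThW; z \<in> carrier ThW\<rbrakk> \<Longrightarrow> extend_W (y \<oplus>\<^bsub>ThW\<^esub> z) = extend_W y \<oplus>\<^bsub>CC\<^esub> extend_W z"
  "\<lbrakk>u \<in> carrier That; w \<in> carrier W\<rbrakk>
    \<Longrightarrow> extend_W (pure_tensor S \<beta> That W u w) = extend_A u (proj_A w)"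
proof -
  have "balanced S \<beta> That W CC (\<lambda>u w. extend_A u (proj_A w))"
    by (rule balancedI) simp_all
  note ThTC_R.M_NP.lift_simps[OF CC.tensor_abelian this, folded extend_W_def]
  then show "z \<in> carrier ThW \<Longrightarrow> extend_W z \<in> carrier CC"
    "\<lbrakk>y \<in> carrier ThW; z \<in> carrier ThW\<rbrakk> \<Longrightarrow> extend_W (y \<oplus>\<^bsub>ThW\<^esub> z) = extend_W y \<oplus>\<^bsub>CC\<^esub> extend_W z"
    "\<lbrakk>u \<in> carrier That; w \<in> carrier W\<rbrakk>
      \<Longrightarrow> extend_W (pure_tensor S \<beta> That W u w) = extend_A u (proj_A w)"
    by simp_all
qed

lemma extend_W_hom: "extend_W \<in> add_hom ThW CC"
  by (rule add_homI) simp_all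

lemma extend_W_lact [simp]:
  "\<lbrakk>z \<in> carrier ThW; a \<in> carrier A\<rbrakk> \<Longrightarrow> extend_W (a \<triangleright>\<^bsub>ThW\<^esub> z) = a \<triangleright>\<^bsub>CC\<^esub> extend_W z"
  by (induction z rule: ThTC_R.M_NP.tensor_induct) simp_all

lemma comodule_coassoc_A:
  assumes x: "x \<in> carrier T"
  shows "tensor_assoc A id A id T CA CA (tensor_map A id TC CA gamma_A id (gamma_A x))
    = tensor_map A id T CC id Delta_A (gamma_A x)"
proof -
  note [simp] = TThT.M_NP.map_simps[where f = \<gamma> and g = id,
      OF TCC_R.MN_P.tensor_product_axioms gamma_add_hom id_add_hom]
    TCC_R.M_NP.map_simps[where f = id and g = "tensor_assoc S \<beta> R \<alpha> That T CA",
      OF TThW.M_NP.tensor_product_axioms id_add_hom ThTC_R.assoc_hom]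
    CA.map_simps[where f = id and g = \<gamma>, OF ThTC_R.M_NP.tensor_product_axioms id_add_hom gamma_add_hom]
    TThW.M_NP.map_simps[where f = id and g = extend_W,
      OF TCC.M_NP.tensor_product_axioms id_add_hom extend_W_hom]
    TC.map_simps[where f = id and g = Delta_A,
      OF TCC.M_NP.tensor_product_axioms id_add_hom Delta_A_hom]
    TC.map_simps[where f = gamma_A and g = id,
      OF TCC.MN_P.tensor_product_axioms gamma_A_hom id_add_hom]
  have g: "tensor_map S \<beta> That W id \<gamma> \<in> add_hom CA ThW"
    by (rule add_homI) (simp_all add: ThTC_R.M_NP.pure_balanced)
  \<comment> \<open>Left linearity lets this map stand in the second slot of a tensor product over
    \<open>R\<close>, where scalars enter through \<open>\<alpha>\<close>.\<close>
  have act: "tensor_map S \<beta> That W id \<gamma> (a \<triangleright>\<^bsub>CA\<^esub> c) = a \<triangleright>\<^bsub>ThW\<^esub> tensor_map S \<beta> That W id \<gamma> c"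
    if "c \<in> carrier CA" "a \<in> carrier A" for a c
    using that by (induction c rule: CA.tensor_induct) (simp_all add: ThTC_R.M_NP.pure_balanced)
  note [simp] = TThT.M_NP.map_simps[where f = id and g = "tensor_map S \<beta> That W id \<gamma>",
      OF TThW.M_NP.tensor_product_axioms id_add_hom g]
  \<comment> \<open>\<open>?P\<close> leads from the space of the herd axiom to T \<otimes> (C
    \<otimes> C) over \<open>A\<close>: \<open>extend_W\<close> rebrackets the inner part, and both
    inner and outer tensor signs pass from \<open>R\<close> to \<open>A\<close>. The facts
    \<open>left\<close> and \<open>right\<close> compute the images of the two sides of the
    axiom.\<close>
  let ?P = "tensor_map A id T CC id extend_W"
  \<comment> \<open>Induction leaves \<open>id\<close> eta-expanded, which simp turns into \<open>\<lambda>a. a\<close>; flipping \<open>id_def\<close> restores it.\<close>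
  have right: "?P (tensor_map R \<alpha> T ThW id (tensor_map S \<beta> That W id \<gamma>) w)
      = tensor_map A id T CC id Delta_A (proj_A w)" if "w \<in> carrier W" for w
    using that
    by (induction w rule: TThT.M_NP_induct) (simp_all add: act ThTC_R.M_NP.pure_balanced flip: id_def gamma_A_proj)
  \<comment> \<open>After \<open>\<gamma>\<close> has been applied to the first leg, that slot holds
    an element of \<open>W\<close> that need not be pure; the identity is therefore proved for every
    \<open>v\<close> in \<open>W\<close>.\<close>
  have left': "?P (tensor_map R \<alpha> T ThW id (tensor_assoc S \<beta> R \<alpha> That T CA)
        (tensor_assoc R \<alpha> R \<alpha> T CA CA (pure_tensor R \<alpha> W CA v c)))
      = tensor_assoc A id A id T CA CA (pure_tensor A id TC CA (proj_A v) c)"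
    if "v \<in> carrier W" "c \<in> carrier CA" for v c
    using that by (induction v rule: TThT.M_NP_induct) (simp_all flip: id_def)
  have left: "?P (tensor_map R \<alpha> T ThW id (tensor_assoc S \<beta> R \<alpha> That T CA)
        (tensor_assoc R \<alpha> R \<alpha> T CA CA (tensor_map R \<alpha> W CA \<gamma> id w)))
      = tensor_assoc A id A id T CA CA (tensor_map A id TC CA gamma_A id (proj_A w))"
    if "w \<in> carrier W" for w
    using that by (induction w rule: TThT.M_NP.tensor_induct) (simp_all add: left' flip: id_def gamma_A_proj)
  show ?thesis
    using x shepherd_coassoc[of x] left[of "\<gamma> x"] right[of "\<gamma> x"] by (simp add: gamma_A_proj Let_def)
qed

lemma coring_coassoc_A:
  assumes c: "c \<in> carrier CA"
  shows "tensor_assoc A id A id CA CA CA (tensor_map A id CC CA Delta_A id (Delta_A c))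
    = tensor_map A id CA CC id Delta_A (Delta_A c)"
proof -
  note [simp] = CC.map_simps[where f = id and g = Delta_A,
      OF CCC.M_NP.tensor_product_axioms id_add_hom Delta_A_hom]
    CC.map_simps[where f = Delta_A and g = id,
      OF CCC.MN_P.tensor_product_axioms Delta_A_hom id_add_hom]
    TC.map_simps[where f = id and g = Delta_A,
      OF TCC.M_NP.tensor_product_axioms id_add_hom Delta_A_hom]
    TC.map_simps[where f = gamma_A and g = id,
      OF TCC.MN_P.tensor_product_axioms gamma_A_hom id_add_hom]
  have pure: "tensor_assoc A id A id CA CA CA (tensor_map A id CC CA Delta_A id (extend_A u (gamma_A x)))
      = tensor_map A id CA CC id Delta_A (extend_A u (gamma_A x))"
    if ux: "u \<in> carrier That" "x \<in> carrier T" for u x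
  proof -
    note [simp] = TCC.M_NP.map_simps[where f = "pC u" and g = id,
      OF CCC.M_NP.tensor_product_axioms CA.pure_right_hom id_add_hom, OF ux(1)]
    \<comment> \<open>Tensoring the first factor with \<open>u\<close>. Since x \<mapsto> u
      \<otimes> x intertwines \<open>gamma_A\<close> with \<open>Delta_A\<close>, this map carries
      both sides of the comodule law for x to the two sides of the coring law for u \<otimes>
      x.\<close>
    let ?E = "tensor_map A id CA CC (pC u) id"
    have bal: "pure_tensor A id CA CC (pC u (t \<triangleleft>\<^bsub>T\<^esub> a)) z = pure_tensor A id CA CC (pC u t) (a \<triangleright>\<^bsub>CC\<^esub> z)"
      if "t \<in> carrier T" "a \<in> carrier A" "z \<in> carrier CC" for t a z
      using that ux by (simp flip: CA.ract_pure)
    note [simp] = bal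
    have assoc: "tensor_assoc A id A id CA CA CA (pure_tensor A id CC CA (extend_A u Z) d)
        = ?E (tensor_assoc A id A id T CA CA (pure_tensor A id TC CA Z d))"
      if "Z \<in> carrier TC" "d \<in> carrier CA" for Z d
      using that ux by (induction Z rule: TC.tensor_induct) (simp_all flip: id_def)
    have "tensor_assoc A id A id CA CA CA (tensor_map A id CC CA Delta_A id (extend_A u Y))
        = ?E (tensor_assoc A id A id T CA CA (tensor_map A id TC CA gamma_A id Y))"
      if "Y \<in> carrier TC" for Y
      using that ux by (induction Y rule: TC.tensor_induct) (simp_all add: assoc flip: id_def)
    moreover have "tensor_map A id CA CC id Delta_A (extend_A u Y)
        = ?E (tensor_map A id T CC id Delta_A Y)"
      if "Y \<in> carrier TC" for Y
      using that ux by (induction Y rule: TC.tensor_induct) (simp_all flip: id_def)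
    ultimately show ?thesis
      using ux by (simp add: comodule_coassoc_A)
  qed
  show ?thesis
    using c by (induction c rule: CA.tensor_induct) (simp_all add: pure flip: id_def)
qed

lemma coring_A: "coring A CA Delta_A ev"
proof (intro coring.intro coring_axioms.intro)
  show "Delta_A \<in> bimod_hom A A CA CC"
    by (rule bimod_homI) (simp_all add: Delta_A_hom)
qed (simp_all add: CA.tensor_bimodule ev_hom coring_coassoc_A coring_counit_left_A coring_counit_right_A)

lemma comodule_A: "right_comodule A CA Delta_A ev T gamma_A"
proof (intro right_comodule.intro right_comodule_axioms.intro coring_A)
  show "right_module A T" by (rule T.right_module_axioms)
  show "gamma_A \<in> right_hom A T TC"
    using gamma_A_hom by (simp add: right_hom_def)
qed (simp_all add: comodule_coassoc_A comodule_counit_A)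

section \<open>Isomorphism with the tensor product of the right dual\<close>

lemma isomorphic_A: "bimod_isomorphic A A CA (tensor S \<beta> (right_dual A T) T)"
proof -
  let ?Z = "tensor S \<beta> (right_dual A T) T"
  let ?p = "pure_tensor S \<beta> (right_dual A T) T"
  define h where "h = tensor_map S \<beta> (right_dual A T) T ev_map id"
  \<comment> \<open>The candidate inverse f \<otimes> x \<mapsto> f(x1) x2 \<otimes> x3. That it is
    a left inverse of \<open>h\<close> is \<open>contract_A_gamma\<close>.\<close>
  define g where "g = tensor_lift CA (\<lambda>f x. contract_A f (\<gamma> x))"
  have "ev_map (u \<oplus>\<^bsub>That\<^esub> v) = ev_map u \<oplus>\<^bsub>right_dual A T\<^esub> ev_map v"
    if "u \<in> carrier That" "v \<in> carrier That" for u v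
    using that by (auto simp: T.right_dual_ops ev_map_def intro!: restrict_ext)
  then have ev_map_hom: "ev_map \<in> add_hom That (right_dual A T)"
    by (intro add_homI) simp_all
  have ev_map_balanced: "ev_map (u \<triangleleft>\<^bsub>That\<^esub> \<beta> s) = ev_map u \<triangleleft>\<^bsub>right_dual A T\<^esub> \<beta> s"
    if "u \<in> carrier That" "s \<in> carrier S" for u s
    using that by (auto simp: T.right_dual_ops ev_map_def CA.pure_balanced intro!: restrict_ext)
  have ev_map_lact: "ev_map (a \<triangleright>\<^bsub>That\<^esub> u) = a \<triangleright>\<^bsub>right_dual A T\<^esub> ev_map u"
    if "u \<in> carrier That" "a \<in> carrier A" for u a
    using that by (auto simp: T.right_dual_ops ev_map_def simp flip: CA.lact_pure intro!: restrict_ext)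
  have bal: "?p (ev_map (u \<triangleleft>\<^bsub>That\<^esub> \<beta> s)) (id x) = ?p (ev_map u) (id (\<beta> s \<triangleright>\<^bsub>T\<^esub> x))"
    if "u \<in> carrier That" "s \<in> carrier S" "x \<in> carrier T" for u s x
    using that by (simp add: ev_map_balanced RDT.pure_balanced)
  note [simp] = CA.map_simps[where f = ev_map and g = id,
      OF RDT.tensor_product_axioms ev_map_hom id_add_hom bal, folded h_def, unfolded id_apply]
  have contract_add: "contract_A (f \<oplus>\<^bsub>right_dual A T\<^esub> f') w = contract_A f w \<oplus>\<^bsub>CA\<^esub> contract_A f' w"
    if "w \<in> carrier W" "f \<in> carrier (right_dual A T)" "f' \<in> carrier (right_dual A T)" for f f' w
    using that
    by (induction w rule: TThT.M_NP.tensor_induct)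
       (simp_all add: T.right_dual_apply T.right_dual_closed CA.tensor.add_lact CA.a_ac)
  have contract_balanced: "contract_A (f \<triangleleft>\<^bsub>right_dual A T\<^esub> \<beta> s) w = contract_A f (\<beta> s \<triangleright>\<^bsub>W\<^esub> w)"
    if "w \<in> carrier W" "f \<in> carrier (right_dual A T)" "s \<in> carrier S" for f s w
    using that
    by (induction w rule: TThT.M_NP.tensor_induct) (simp_all add: T.right_dual_apply)
  have "balanced S \<beta> (right_dual A T) T CA (\<lambda>f x. contract_A f (\<gamma> x))"
    by (rule balancedI) (simp_all add: contract_add contract_balanced)
  note [simp] = RDT.lift_simps[OF CA.tensor_abelian this, folded g_def]
  have gh: "g (h c) = c" if "c \<in> carrier CA" for c
    using that by (induction c rule: CA.tensor_induct) simp_all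
  \<comment> \<open>For t in \<open>T\<close>: ev(f(x) u \<otimes> t) = f(x) ev(u \<otimes> t) = f(x
    ev(u \<otimes> t)) = f(evh(x \<otimes> u) t), by right linearity of \<open>f\<close> and
    \<open>evh_ev\<close>.\<close>
  have dual: "ev_map (f x \<triangleright>\<^bsub>That\<^esub> u) = f \<triangleleft>\<^bsub>right_dual A T\<^esub> evh (pD x u)"
    if "f \<in> carrier (right_dual A T)" "x \<in> carrier T" "u \<in> carrier That" for f x u
    using that
    by (auto simp: T.right_dual_ops T.right_dual_carrier ev_map_def evh_ev simp flip: CA.lact_pure
        intro!: restrict_ext)
  have contract_gamma: "h (contract_A f (\<gamma> x)) = ?p f x"
    if f: "f \<in> carrier (right_dual A T)" and x: "x \<in> carrier T" for f x
  proof -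
    have "balanced S \<beta> (regular B) T ?Z (\<lambda>b y. ?p (f \<triangleleft>\<^bsub>right_dual A T\<^esub> b) y)"
      using f by (intro balancedI) (simp_all add: RD.add_ract RD.mult_ract RDT.pure_balanced)
    note [simp] = BT.lift_simps[OF RDT.tensor_abelian this]
    \<comment> \<open>By \<open>dual\<close> the functional moves across to \<open>evh\<close>, so
      the composite factors through \<open>evh_T\<close>; at \<open>\<gamma> x\<close> only f 1
      \<otimes> x is left.\<close>
    have "h (contract_A f w) = tensor_lift ?Z (\<lambda>b y. ?p (f \<triangleleft>\<^bsub>right_dual A T\<^esub> b) y) (evh_T w)"
      if "w \<in> carrier W" for w
      using that f
      by (induction w rule: TThT.M_NP_induct) (simp_all add: dual T.right_dual_closed)
    from this[of "\<gamma> x"] show ?thesis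
      using f x by simp
  qed
  have hg: "h (g z) = z" if "z \<in> carrier ?Z" for z
    using that by (induction z rule: RDT.tensor_induct) (simp_all add: contract_gamma)
  have "bij_betw h (carrier CA) (carrier ?Z)"
    by (rule bij_betwI[where g = g]) (auto simp: gh hg)
  moreover have "h (a \<triangleright>\<^bsub>CA\<^esub> c) = a \<triangleright>\<^bsub>?Z\<^esub> h c" if "c \<in> carrier CA" "a \<in> carrier A" for a c
    using that by (induction c rule: CA.tensor_induct) (simp_all add: ev_map_lact)
  moreover have "h (c \<triangleleft>\<^bsub>CA\<^esub> a) = h c \<triangleleft>\<^bsub>?Z\<^esub> a" if "c \<in> carrier CA" "a \<in> carrier A" for a c
    using that by (induction c rule: CA.tensor_induct) simp_all
  moreover have "h \<in> add_hom CA ?Z"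
    by (rule add_homI) simp_all
  ultimately show ?thesis
    unfolding bimod_isomorphic_def by (blast intro: bimod_homI)
qed

section \<open>The \<open>B\<close>-coring\<close>

abbreviation "DT \<equiv> tensor B id DB T"
abbreviation "DD \<equiv> tensor B id DB DB"
abbreviation "pDT \<equiv> pure_tensor B id DB T"
abbreviation "pDD \<equiv> pure_tensor B id DB DB"

interpretation DD: tensor_product B B B DB DB B id
  by unfold_locales simp

interpretation DT: tensor_product B B A DB T B id
  by unfold_locales simp

interpretation DDT: tensor_product3 B B B A DB DB T B id B id
  by unfold_locales

interpretation DDD: tensor_product3 B B B B DB DB DB B id B id
  by unfold_locales

interpretation DTTh: tensor_product3 B B A B DB T That B id R \<alpha>
  by unfold_locales

interpretation LD: bimodule A B "left_dual B T"
  by (rule T.left_dual_bimodule)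

interpretation TLD: tensor_product B A B T "left_dual B T" R \<alpha>
  by unfold_locales simp

lemmas middle_B [simp] =
  DT.tensor_product_axioms [THEN tensor_product_middle] DD.tensor_product_axioms [THEN tensor_product_middle]
  DDT.MN_P.tensor_product_axioms [THEN tensor_product_middle]
  DDT.M_NP.tensor_product_axioms [THEN tensor_product_middle]
  DDD.MN_P.tensor_product_axioms [THEN tensor_product_middle]
  DDD.M_NP.tensor_product_axioms [THEN tensor_product_middle]

text \<open>Simplification moves a right action on \<open>pD x u\<close> into its second entry,
  after which the general rule no longer matches; this is that rule in normal form.\<close>

lemma middle_pure_B [simp]:
  "\<lbrakk>x \<in> carrier T; u \<in> carrier That; b \<in> carrier B; y \<in> carrier T\<rbrakk>
    \<Longrightarrow> pDT (pD x (u \<triangleleft>\<^bsub>That\<^esub> b)) y = pDT (pD x u) (b \<triangleright>\<^bsub>T\<^esub> y)"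
  using DT.tensor_product_axioms [THEN tensor_product_middle, of "pD x u" b y] by simp

text \<open>The shepherd takes values in tensors bracketed to the right, so they are rebracketed
  before projecting. For this reason the inductions on the \<open>B\<close> side usually go down to
  pure triples.\<close>

definition "proj_B w = tensor_map B id DB T id id (tensor_assoc_inv R \<alpha> S \<beta> T That T w)"

lemma proj_B_simps [simp]:
  "w \<in> carrier W \<Longrightarrow> proj_B w \<in> carrier DT"
  "\<lbrakk>v \<in> carrier W; w \<in> carrier W\<rbrakk> \<Longrightarrow> proj_B (v \<oplus>\<^bsub>W\<^esub> w) = proj_B v \<oplus>\<^bsub>DT\<^esub> proj_B w"
  "\<lbrakk>x \<in> carrier T; u \<in> carrier That; y \<in> carrier T\<rbrakk> \<Longrightarrow> proj_B (pW x (pC u y)) = pDT (pD x u) y"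
  by (simp_all add: proj_B_def
    TThT.MN_P.map_simps[where f = id and g = id, OF DT.tensor_product_axioms id_add_hom id_add_hom])

lemma proj_B_act [simp]:
  "\<lbrakk>w \<in> carrier W; b \<in> carrier B\<rbrakk> \<Longrightarrow> proj_B (b \<triangleright>\<^bsub>W\<^esub> w) = b \<triangleright>\<^bsub>DT\<^esub> proj_B w"
  "\<lbrakk>w \<in> carrier W; a \<in> carrier A\<rbrakk> \<Longrightarrow> proj_B (w \<triangleleft>\<^bsub>W\<^esub> a) = proj_B w \<triangleleft>\<^bsub>DT\<^esub> a"
  by (induction w rule: TThT.M_NP_induct) simp_all

lemma proj_B_hom: "proj_B \<in> add_hom W DT"
  by (rule add_homI) simp_all

section \<open>The left coaction over B\<close>

definition "gamma_B = shepherd_B R S B \<alpha> \<beta> T That \<gamma>"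

lemma gamma_B_proj: "gamma_B x = proj_B (\<gamma> x)"
  by (simp add: gamma_B_def shepherd_B_def proj_B_def)

lemma gamma_B_simps [simp]:
  "x \<in> carrier T \<Longrightarrow> gamma_B x \<in> carrier DT"
  "\<lbrakk>x \<in> carrier T; y \<in> carrier T\<rbrakk> \<Longrightarrow> gamma_B (x \<oplus>\<^bsub>T\<^esub> y) = gamma_B x \<oplus>\<^bsub>DT\<^esub> gamma_B y"
  "\<lbrakk>r \<in> carrier R; x \<in> carrier T\<rbrakk> \<Longrightarrow> gamma_B (x \<triangleleft>\<^bsub>T\<^esub> \<alpha> r) = gamma_B x \<triangleleft>\<^bsub>DT\<^esub> \<alpha> r"
  by (simp_all add: gamma_B_proj)

lemma gamma_B_hom: "gamma_B \<in> add_hom T DT"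
  by (rule add_homI) simp_all

definition evh_map where "evh_map u = (\<lambda>t\<in>carrier T. evh (pD t u))"

lemma evh_map_app [simp]: "t \<in> carrier T \<Longrightarrow> evh_map u t = evh (pD t u)"
  by (simp add: evh_map_def)

lemma evh_map_closed [simp]: "u \<in> carrier That \<Longrightarrow> evh_map u \<in> carrier (left_dual B T)"
  by (auto simp: T.left_dual_carrier evh_map_def simp flip: DB.lact_pure)

definition contract_B where
  "contract_B f w = tensor_lift DB (\<lambda>d t. d \<triangleleft>\<^bsub>DB\<^esub> f t) (tensor_assoc_inv R \<alpha> S \<beta> T That T w)"

lemma contract_B_simps [simp]:
  assumes f: "f \<in> carrier (left_dual B T)"
  shows "w \<in> carrier W \<Longrightarrow> contract_B f w \<in> carrier DB"
    and "\<lbrakk>v \<in> carrier W; w \<in> carrier W\<rbrakk> \<Longrightarrow> contract_B f (v \<oplus>\<^bsub>W\<^esub> w) = contract_B f v \<oplus>\<^bsub>DB\<^esub> contract_B f w"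
    and "\<lbrakk>x \<in> carrier T; u \<in> carrier That; y \<in> carrier T\<rbrakk> \<Longrightarrow> contract_B f (pW x (pC u y)) = pD x (u \<triangleleft>\<^bsub>That\<^esub> f y)"
proof -
  have "balanced S \<beta> DB T DB (\<lambda>d t. d \<triangleleft>\<^bsub>DB\<^esub> f t)"
    using f by (intro balancedI)
      (simp_all add: T.left_dual_carrier DB.tensor.add_ract DB.tensor.mult_ract)
  note [simp] = TThT.MN_P.lift_simps[OF DB.tensor_abelian this]
  show "w \<in> carrier W \<Longrightarrow> contract_B f w \<in> carrier DB"
    "\<lbrakk>v \<in> carrier W; w \<in> carrier W\<rbrakk> \<Longrightarrow> contract_B f (v \<oplus>\<^bsub>W\<^esub> w) = contract_B f v \<oplus>\<^bsub>DB\<^esub> contract_B f w"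
    "\<lbrakk>x \<in> carrier T; u \<in> carrier That; y \<in> carrier T\<rbrakk> \<Longrightarrow> contract_B f (pW x (pC u y)) = pD x (u \<triangleleft>\<^bsub>That\<^esub> f y)"
    using f by (simp_all add: contract_B_def T.left_dual_closed)
qed

text \<open>Here \<open>ev_evh\<close> is read in the other direction: y1 \<otimes> y2 evh(y3
  \<otimes> u) = y1 \<otimes> ev(y2 \<otimes> y3) u, which factors through \<open>T_ev\<close> and
  becomes y \<otimes> 1 u by the second normalisation axiom.\<close>

lemma contract_B_gamma [simp]:
  assumes u: "u \<in> carrier That" and y: "y \<in> carrier T"
  shows "contract_B (evh_map u) (\<gamma> y) = pD y u"
proof -
  let ?J = "tensor_lift DB (\<lambda>x a. pD x (a \<triangleright>\<^bsub>That\<^esub> u))"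
  have "balanced R \<alpha> T (regular A) DB (\<lambda>x a. pD x (a \<triangleright>\<^bsub>That\<^esub> u))"
    using u by (intro balancedI) (simp_all add: That.add_lact That.mult_lact DB.pure_balanced)
  note [simp] = TA.lift_simps[OF DB.tensor_abelian this]
  have "contract_B (evh_map u) w = ?J (T_ev w)" if "w \<in> carrier W" for w
    using that u by (induction w rule: TThT.M_NP_induct) (simp_all add: ev_evh)
  from this[of "\<gamma> y"] show ?thesis
    using u y by simp
qed

text \<open>On the last leg, x3 ev(u \<otimes> y) = evh(x3 \<otimes> u) y; the scalar of
  \<open>B\<close> crosses the tensor sign to the left, where it completes the contraction with
  \<open>evh_map u\<close>.\<close>

lemma gamma_B_ev:
  assumes "x \<in> carrier T" "u \<in> carrier That" "y \<in> carrier T"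
  shows "gamma_B x \<triangleleft>\<^bsub>DT\<^esub> ev (pC u y) = pDT (pD x u) y"
proof -
  have "proj_B w \<triangleleft>\<^bsub>DT\<^esub> ev (pC u y) = pDT (contract_B (evh_map u) w) y" if "w \<in> carrier W" for w
    using that assms(2,3)
    by (induction w rule: TThT.M_NP_induct) (simp_all add: evh_ev)
  from this[of "\<gamma> x"] show ?thesis
    using assms by (simp add: gamma_B_proj)
qed

text \<open>Well defined on a tensor product over \<open>R\<close> because \<open>gamma_B\<close> is
  right linear over \<open>R\<close>.\<close>

definition act_gamma_B where "act_gamma_B = tensor_lift DT (\<lambda>x a. gamma_B x \<triangleleft>\<^bsub>DT\<^esub> a)"

lemma act_gamma_B_simps [simp]:
  "X \<in> carrier (tensor R \<alpha> T (regular A)) \<Longrightarrow> act_gamma_B X \<in> carrier DT"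
  "\<lbrakk>X \<in> carrier (tensor R \<alpha> T (regular A)); Y \<in> carrier (tensor R \<alpha> T (regular A))\<rbrakk>
    \<Longrightarrow> act_gamma_B (X \<oplus>\<^bsub>tensor R \<alpha> T (regular A)\<^esub> Y) = act_gamma_B X \<oplus>\<^bsub>DT\<^esub> act_gamma_B Y"
  "\<lbrakk>x \<in> carrier T; a \<in> carrier A\<rbrakk>
    \<Longrightarrow> act_gamma_B (pure_tensor R \<alpha> T (regular A) x a) = gamma_B x \<triangleleft>\<^bsub>DT\<^esub> a"
proof -
  have "balanced R \<alpha> T (regular A) DT (\<lambda>x a. gamma_B x \<triangleleft>\<^bsub>DT\<^esub> a)"
    by (rule balancedI) (simp_all add: DT.tensor.add_ract DT.tensor.mult_ract)
  note TA.lift_simps[OF DT.tensor_abelian this, folded act_gamma_B_def]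
  then show "X \<in> carrier (tensor R \<alpha> T (regular A)) \<Longrightarrow> act_gamma_B X \<in> carrier DT"
    "\<lbrakk>X \<in> carrier (tensor R \<alpha> T (regular A)); Y \<in> carrier (tensor R \<alpha> T (regular A))\<rbrakk>
      \<Longrightarrow> act_gamma_B (X \<oplus>\<^bsub>tensor R \<alpha> T (regular A)\<^esub> Y) = act_gamma_B X \<oplus>\<^bsub>DT\<^esub> act_gamma_B Y"
    "\<lbrakk>x \<in> carrier T; a \<in> carrier A\<rbrakk>
      \<Longrightarrow> act_gamma_B (pure_tensor R \<alpha> T (regular A) x a) = gamma_B x \<triangleleft>\<^bsub>DT\<^esub> a"
    by simp_all
qed

lemma gamma_B_lact [simp]:
  assumes x: "x \<in> carrier T" and b: "b \<in> carrier B"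
  shows "gamma_B (b \<triangleright>\<^bsub>T\<^esub> x) = b \<triangleright>\<^bsub>DT\<^esub> gamma_B x"
proof -
  have G: "act_gamma_B (T_ev w) = proj_B w" if "w \<in> carrier W" for w
    using that by (induction w rule: TThT.M_NP_induct) (simp_all add: gamma_B_ev)
  have "b \<triangleright>\<^bsub>DT\<^esub> gamma_B x = proj_B (b \<triangleright>\<^bsub>W\<^esub> \<gamma> x)"
    using x b by (simp add: gamma_B_proj)
  \<comment> \<open>\<open>T_ev_lact\<close> is withheld until the next step, where it brings the
    argument of \<open>act_gamma_B\<close> to b x \<otimes> 1.\<close>
  also have "\<dots> = act_gamma_B (T_ev (b \<triangleright>\<^bsub>W\<^esub> \<gamma> x))"
    using x b by (simp add: G del: T_ev_lact)
  also have "\<dots> = gamma_B (b \<triangleright>\<^bsub>T\<^esub> x)"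
    using x b by simp
  finally show ?thesis ..
qed

section \<open>The coproduct over B\<close>

definition extend_B where "extend_B u = tensor_map B id DB DB id (\<lambda>x. pD x u)"

lemma extend_B_simps [simp]:
  assumes u: "u \<in> carrier That"
  shows "Y \<in> carrier DT \<Longrightarrow> extend_B u Y \<in> carrier DD"
    and "\<lbrakk>X \<in> carrier DT; Y \<in> carrier DT\<rbrakk> \<Longrightarrow> extend_B u (X \<oplus>\<^bsub>DT\<^esub> Y) = extend_B u X \<oplus>\<^bsub>DD\<^esub> extend_B u Y"
    and "\<lbrakk>x \<in> carrier T; d \<in> carrier DB\<rbrakk> \<Longrightarrow> extend_B u (pDT d x) = pDD d (pD x u)"
  using u
  by (simp_all add: extend_B_def DT.map_simps[where f = id and g = "\<lambda>x. pD x u",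
      OF DD.tensor_product_axioms id_add_hom DB.pure_left_hom])

lemma extend_B_linear [simp]:
  assumes Y: "Y \<in> carrier DT"
  shows "\<lbrakk>u \<in> carrier That; v \<in> carrier That\<rbrakk>
      \<Longrightarrow> extend_B (u \<oplus>\<^bsub>That\<^esub> v) Y = extend_B u Y \<oplus>\<^bsub>DD\<^esub> extend_B v Y"
    and "\<lbrakk>u \<in> carrier That; r \<in> carrier R\<rbrakk>
      \<Longrightarrow> extend_B (\<alpha> r \<triangleright>\<^bsub>That\<^esub> u) Y = extend_B u (Y \<triangleleft>\<^bsub>DT\<^esub> \<alpha> r)"
    and "\<lbrakk>u \<in> carrier That; b \<in> carrier B\<rbrakk>
      \<Longrightarrow> extend_B (u \<triangleleft>\<^bsub>That\<^esub> b) Y = extend_B u Y \<triangleleft>\<^bsub>DD\<^esub> b"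
    and "\<lbrakk>u \<in> carrier That; b \<in> carrier B\<rbrakk>
      \<Longrightarrow> extend_B u (b \<triangleright>\<^bsub>DT\<^esub> Y) = b \<triangleright>\<^bsub>DD\<^esub> extend_B u Y"
  using Y
  by (induction Y rule: DT.tensor_induct)
     (simp_all add: DD.a_ac DB.pure_balanced)

lemma extend_B_hom: "u \<in> carrier That \<Longrightarrow> extend_B u \<in> add_hom DT DD"
  by (rule add_homI) simp_all

definition Delta_B where "Delta_B = tensor_lift DD (\<lambda>x u. extend_B u (gamma_B x))"

lemma Delta_B_simps [simp]:
  "d \<in> carrier DB \<Longrightarrow> Delta_B d \<in> carrier DD"
  "\<lbrakk>c \<in> carrier DB; d \<in> carrier DB\<rbrakk> \<Longrightarrow> Delta_B (c \<oplus>\<^bsub>DB\<^esub> d) = Delta_B c \<oplus>\<^bsub>DD\<^esub> Delta_B d"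
  "\<lbrakk>u \<in> carrier That; x \<in> carrier T\<rbrakk> \<Longrightarrow> Delta_B (pD x u) = extend_B u (gamma_B x)"
proof -
  have "balanced R \<alpha> T That DD (\<lambda>x u. extend_B u (gamma_B x))"
    by (rule balancedI) simp_all
  note DB.lift_simps[OF DD.tensor_abelian this]
  then show "d \<in> carrier DB \<Longrightarrow> Delta_B d \<in> carrier DD"
    "\<lbrakk>c \<in> carrier DB; d \<in> carrier DB\<rbrakk> \<Longrightarrow> Delta_B (c \<oplus>\<^bsub>DB\<^esub> d) = Delta_B c \<oplus>\<^bsub>DD\<^esub> Delta_B d"
    "\<lbrakk>u \<in> carrier That; x \<in> carrier T\<rbrakk> \<Longrightarrow> Delta_B (pD x u) = extend_B u (gamma_B x)"
    by (simp_all add: Delta_B_def)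
qed

lemma Delta_B_hom: "Delta_B \<in> add_hom DB DD"
  by (rule add_homI) simp_all

text \<open>The roles of the sides are exchanged: left linearity rests on
  \<open>gamma_B_lact\<close>, and right linearity comes from the factor in the pen.\<close>

lemma Delta_B_act [simp]:
  "\<lbrakk>d \<in> carrier DB; b \<in> carrier B\<rbrakk> \<Longrightarrow> Delta_B (b \<triangleright>\<^bsub>DB\<^esub> d) = b \<triangleright>\<^bsub>DD\<^esub> Delta_B d"
  "\<lbrakk>d \<in> carrier DB; b \<in> carrier B\<rbrakk> \<Longrightarrow> Delta_B (d \<triangleleft>\<^bsub>DB\<^esub> b) = Delta_B d \<triangleleft>\<^bsub>DD\<^esub> b"
  by (induction d rule: DB.tensor_induct) simp_all

lemma Delta_B_pure:
  assumes "u \<in> carrier That" "x \<in> carrier T"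
  shows "Delta_B (pD x u) = tensor_assoc B id R \<alpha> DB T That (pure_tensor R \<alpha> DT That (gamma_B x) u)"
proof -
  have "extend_B u Y = tensor_assoc B id R \<alpha> DB T That (pure_tensor R \<alpha> DT That Y u)"
    if "Y \<in> carrier DT" for Y
    using that assms(1) by (induction Y rule: DT.tensor_induct) simp_all
  then show ?thesis
    using assms by simp
qed

section \<open>Counit laws over B\<close>

lemma coring_counit_right_B:
  assumes "d \<in> carrier DB"
  shows "tensor_lift DB (\<lambda>x y. x \<triangleleft>\<^bsub>DB\<^esub> evh y) (Delta_B d) = d"
proof -
  have "balanced B id DB DB DB (\<lambda>x y. x \<triangleleft>\<^bsub>DB\<^esub> evh y)"
    by (rule balancedI) (simp_all add: DB.tensor.add_ract DB.tensor.mult_ract)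
  note E = DD.lift_simps[OF DB.tensor_abelian this]
  \<comment> \<open>Applying \<open>evh\<close> to the second factor after the extension by
    \<open>u\<close> is contraction with \<open>evh_map u\<close>.\<close>
  have aux: "tensor_lift DB (\<lambda>x y. x \<triangleleft>\<^bsub>DB\<^esub> evh y) (extend_B u (proj_B w)) = contract_B (evh_map u) w"
    if "w \<in> carrier W" "u \<in> carrier That" for w u
    using that by (induction w rule: TThT.M_NP_induct) (simp_all add: E)
  show ?thesis
    using assms by (induction d rule: DB.tensor_induct) (simp_all add: E aux gamma_B_proj)
qed

lemma comodule_counit_B:
  assumes x: "x \<in> carrier T"
  shows "tensor_lift T (\<lambda>d x. evh d \<triangleright>\<^bsub>T\<^esub> x) (gamma_B x) = x"
proof -
  have "balanced B id DB T T (\<lambda>d x. evh d \<triangleright>\<^bsub>T\<^esub> x)"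
    by (rule balancedI) (simp_all add: T.add_lact T.mult_lact)
  note E = DT.lift_simps[OF T.M.abelian_group_axioms this]
  have "balanced S \<beta> (regular B) T T (lact T)"
    by (rule balancedI) (simp_all add: T.add_lact T.mult_lact)
  note m = BT.lift_simps[OF T.M.abelian_group_axioms this]
  have "tensor_lift T (\<lambda>d x. evh d \<triangleright>\<^bsub>T\<^esub> x) (proj_B w) = tensor_lift T (lact T) (evh_T w)"
    if "w \<in> carrier W" for w
    using that by (induction w rule: TThT.M_NP_induct) (simp_all add: E m)
  from this[of "\<gamma> x"] show ?thesis
    using x by (simp add: gamma_B_proj m)
qed

text \<open>The factor in the pen stands on the far right and is untouched, so the law follows from
  the counit law of the left comodule \<open>T\<close>.\<close>

lemma coring_counit_left_B:
  assumes "d \<in> carrier DB"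
  shows "tensor_lift DB (\<lambda>x y. evh x \<triangleright>\<^bsub>DB\<^esub> y) (Delta_B d) = d"
proof -
  have "balanced B id DB DB DB (\<lambda>x y. evh x \<triangleright>\<^bsub>DB\<^esub> y)"
    by (rule balancedI) (simp_all add: DB.tensor.add_lact DB.tensor.mult_lact)
  note E = DD.lift_simps[OF DB.tensor_abelian this]
  have "balanced B id DB T T (\<lambda>d x. evh d \<triangleright>\<^bsub>T\<^esub> x)"
    by (rule balancedI) (simp_all add: T.add_lact T.mult_lact)
  note E' = DT.lift_simps[OF T.M.abelian_group_axioms this]
  have aux: "tensor_lift DB (\<lambda>x y. evh x \<triangleright>\<^bsub>DB\<^esub> y) (extend_B u Y)
      = pD (tensor_lift T (\<lambda>d x. evh d \<triangleright>\<^bsub>T\<^esub> x) Y) u"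
    if "Y \<in> carrier DT" "u \<in> carrier That" for Y u
    using that by (induction Y rule: DT.tensor_induct) (simp_all add: E E')
  show ?thesis
    using assms by (induction d rule: DB.tensor_induct) (simp_all add: E aux comodule_counit_B)
qed

section \<open>Coassociativity over B\<close>

lemma comodule_coassoc_B:
  assumes x: "x \<in> carrier T"
  shows "tensor_assoc B id B id DB DB T (tensor_map B id DD T Delta_B id (gamma_B x))
    = tensor_map B id DB DT id gamma_B (gamma_B x)"
proof -
  note [simp] = TThT.M_NP.map_simps[where f = \<gamma> and g = id,
      OF TCC_R.MN_P.tensor_product_axioms gamma_add_hom id_add_hom]
    TCC_R.M_NP.map_simps[where f = id and g = "tensor_assoc S \<beta> R \<alpha> That T CA",
      OF TThW.M_NP.tensor_product_axioms id_add_hom ThTC_R.assoc_hom]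
    CA.map_simps[where f = id and g = \<gamma>, OF ThTC_R.M_NP.tensor_product_axioms id_add_hom gamma_add_hom]
    TThW.MN_P.map_simps[where f = id and g = proj_B,
      OF DDT.M_NP.tensor_product_axioms id_add_hom proj_B_hom]
    DT.map_simps[where f = id and g = gamma_B,
      OF DDT.M_NP.tensor_product_axioms id_add_hom gamma_B_hom]
    DT.map_simps[where f = Delta_B and g = id,
      OF DDT.MN_P.tensor_product_axioms Delta_B_hom id_add_hom]
  have g: "tensor_map S \<beta> That W id \<gamma> \<in> add_hom CA ThW"
    by (rule add_homI) (simp_all add: ThTC_R.M_NP.pure_balanced)
  have act: "tensor_map S \<beta> That W id \<gamma> (a \<triangleright>\<^bsub>CA\<^esub> c) = a \<triangleright>\<^bsub>ThW\<^esub> tensor_map S \<beta> That W id \<gamma> c"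
    if "c \<in> carrier CA" "a \<in> carrier A" for a c
    using that by (induction c rule: CA.tensor_induct) (simp_all add: ThTC_R.M_NP.pure_balanced)
  note [simp] = TThT.M_NP.map_simps[where f = id and g = "tensor_map S \<beta> That W id \<gamma>",
      OF TThW.M_NP.tensor_product_axioms id_add_hom g]
  \<comment> \<open>The same herd axiom is now sent to D \<otimes> (D \<otimes> T) over
    \<open>B\<close>: rebracketing isolates the first factor \<open>DB\<close>, and
    \<open>proj_B\<close> treats the remaining element of \<open>W\<close>.\<close>
  let ?P = "\<lambda>z. tensor_map B id DB DT id proj_B (tensor_assoc_inv R \<alpha> S \<beta> T That W z)"
  have right: "?P (tensor_map R \<alpha> T ThW id (tensor_map S \<beta> That W id \<gamma>) w)
      = tensor_map B id DB DT id gamma_B (proj_B w)" if "w \<in> carrier W" for w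
    using that
    by (induction w rule: TThT.M_NP_induct)
       (simp_all add: act ThTC_R.M_NP.pure_balanced flip: id_def gamma_B_proj)
  \<comment> \<open>The second leg \<open>u\<close> of the outer triple is absorbed by
    \<open>extend_B u\<close>, which is how \<open>Delta_B\<close> enters although the axiom
    mentions only \<open>\<gamma>\<close>.\<close>
  have left': "?P (tensor_map R \<alpha> T ThW id (tensor_assoc S \<beta> R \<alpha> That T CA)
        (tensor_assoc R \<alpha> R \<alpha> T CA CA (pure_tensor R \<alpha> W CA v (pC u y))))
      = tensor_assoc B id B id DB DB T (pure_tensor B id DD T (extend_B u (proj_B v)) y)"
    if "v \<in> carrier W" "u \<in> carrier That" "y \<in> carrier T" for v u y
    using that by (induction v rule: TThT.M_NP_induct) (simp_all flip: id_def)
  have left: "?P (tensor_map R \<alpha> T ThW id (tensor_assoc S \<beta> R \<alpha> That T CA)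
        (tensor_assoc R \<alpha> R \<alpha> T CA CA (tensor_map R \<alpha> W CA \<gamma> id w)))
      = tensor_assoc B id B id DB DB T (tensor_map B id DD T Delta_B id (proj_B w))"
    if "w \<in> carrier W" for w
    using that by (induction w rule: TThT.M_NP_induct) (simp_all add: left' flip: id_def gamma_B_proj)
  show ?thesis
    using x shepherd_coassoc[of x] left[of "\<gamma> x"] right[of "\<gamma> x"] by (simp add: gamma_B_proj Let_def)
qed

lemma coring_coassoc_B:
  assumes d: "d \<in> carrier DB"
  shows "tensor_assoc B id B id DB DB DB (tensor_map B id DD DB Delta_B id (Delta_B d))
    = tensor_map B id DB DD id Delta_B (Delta_B d)"
proof -
  note [simp] = DD.map_simps[where f = id and g = Delta_B,
      OF DDD.M_NP.tensor_product_axioms id_add_hom Delta_B_hom]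
    DD.map_simps[where f = Delta_B and g = id,
      OF DDD.MN_P.tensor_product_axioms Delta_B_hom id_add_hom]
    DT.map_simps[where f = id and g = gamma_B,
      OF DDT.M_NP.tensor_product_axioms id_add_hom gamma_B_hom]
    DT.map_simps[where f = Delta_B and g = id,
      OF DDT.MN_P.tensor_product_axioms Delta_B_hom id_add_hom]
  have pure: "tensor_assoc B id B id DB DB DB (tensor_map B id DD DB Delta_B id (extend_B u (gamma_B x)))
      = tensor_map B id DB DD id Delta_B (extend_B u (gamma_B x))"
    if ux: "u \<in> carrier That" "x \<in> carrier T" for u x
  proof -
    note [simp] = DDT.M_NP.map_simps[where f = id and g = "extend_B u",
      OF DDD.M_NP.tensor_product_axioms id_add_hom extend_B_hom, OF ux(1)]
    \<comment> \<open>Appending \<open>u\<close> to the last factor carries the comodule law for x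
      to the coring law for x \<otimes> u.\<close>
    let ?E = "tensor_map B id DB DD id (extend_B u)"
    have assoc: "tensor_assoc B id B id DB DB DB (pure_tensor B id DD DB Z (pD t u))
        = ?E (tensor_assoc B id B id DB DB T (pure_tensor B id DD T Z t))"
      if "Z \<in> carrier DD" "t \<in> carrier T" for Z t
      using that ux by (induction Z rule: DD.tensor_induct) (simp_all flip: id_def)
    have "tensor_assoc B id B id DB DB DB (tensor_map B id DD DB Delta_B id (extend_B u Y))
        = ?E (tensor_assoc B id B id DB DB T (tensor_map B id DD T Delta_B id Y))"
      if "Y \<in> carrier DT" for Y
      using that ux by (induction Y rule: DT.tensor_induct) (simp_all add: assoc flip: id_def)
    moreover have "tensor_map B id DB DD id Delta_B (extend_B u Y)
        = ?E (tensor_map B id DB DT id gamma_B Y)"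
      if "Y \<in> carrier DT" for Y
      using that ux by (induction Y rule: DT.tensor_induct) (simp_all flip: id_def)
    ultimately show ?thesis
      using ux by (simp add: comodule_coassoc_B)
  qed
  show ?thesis
    using d by (induction d rule: DB.tensor_induct) (simp_all add: pure flip: id_def)
qed

lemma coring_B: "coring B DB Delta_B evh"
proof (intro coring.intro coring_axioms.intro)
  show "Delta_B \<in> bimod_hom B B DB DD"
    by (rule bimod_homI) (simp_all add: Delta_B_hom)
qed (simp_all add: DB.tensor_bimodule evh_hom coring_coassoc_B coring_counit_left_B coring_counit_right_B)

lemma comodule_B: "left_comodule B DB Delta_B evh T gamma_B"
proof (intro left_comodule.intro left_comodule_axioms.intro coring_B)
  show "left_module B T" by (rule T.left_module_axioms)
  show "gamma_B \<in> left_hom B T DT"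
    using gamma_B_hom by (simp add: left_hom_def)
qed (simp_all add: comodule_coassoc_B comodule_counit_B)

section \<open>Isomorphism with the tensor product of the left dual\<close>

lemma isomorphic_B: "bimod_isomorphic B B DB (tensor R \<alpha> T (left_dual B T))"
proof -
  let ?Z = "tensor R \<alpha> T (left_dual B T)"
  let ?p = "pure_tensor R \<alpha> T (left_dual B T)"
  define h where "h = tensor_map R \<alpha> T (left_dual B T) id evh_map"
  \<comment> \<open>The candidate inverse x \<otimes> f \<mapsto> x1 \<otimes> x2 f(x3); it is a
    left inverse of \<open>h\<close> by \<open>contract_B_gamma\<close>.\<close>
  define g where "g = tensor_lift DB (\<lambda>x f. contract_B f (\<gamma> x))"
  have "evh_map (u \<oplus>\<^bsub>That\<^esub> v) = evh_map u \<oplus>\<^bsub>left_dual B T\<^esub> evh_map v"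
    if "u \<in> carrier That" "v \<in> carrier That" for u v
    using that by (auto simp: T.left_dual_ops evh_map_def intro!: restrict_ext)
  then have evh_map_hom: "evh_map \<in> add_hom That (left_dual B T)"
    by (intro add_homI) simp_all
  have evh_map_balanced: "evh_map (\<alpha> r \<triangleright>\<^bsub>That\<^esub> u) = \<alpha> r \<triangleright>\<^bsub>left_dual B T\<^esub> evh_map u"
    if "u \<in> carrier That" "r \<in> carrier R" for u r
    using that by (auto simp: T.left_dual_ops evh_map_def DB.pure_balanced intro!: restrict_ext)
  have evh_map_ract: "evh_map (u \<triangleleft>\<^bsub>That\<^esub> b) = evh_map u \<triangleleft>\<^bsub>left_dual B T\<^esub> b"
    if "u \<in> carrier That" "b \<in> carrier B" for u b
    using that by (auto simp: T.left_dual_ops evh_map_def simp flip: DB.ract_pure intro!: restrict_ext)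
  have bal: "?p (id (x \<triangleleft>\<^bsub>T\<^esub> \<alpha> r)) (evh_map u) = ?p (id x) (evh_map (\<alpha> r \<triangleright>\<^bsub>That\<^esub> u))"
    if "x \<in> carrier T" "r \<in> carrier R" "u \<in> carrier That" for u r x
    using that by (simp add: evh_map_balanced TLD.pure_balanced)
  note [simp] = DB.map_simps[where f = id and g = evh_map,
      OF TLD.tensor_product_axioms id_add_hom evh_map_hom bal, folded h_def, unfolded id_apply]
  have contract_add: "contract_B (f \<oplus>\<^bsub>left_dual B T\<^esub> f') w = contract_B f w \<oplus>\<^bsub>DB\<^esub> contract_B f' w"
    if "w \<in> carrier W" "f \<in> carrier (left_dual B T)" "f' \<in> carrier (left_dual B T)" for f f' w
    using that
    by (induction w rule: TThT.M_NP_induct)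
       (simp_all add: T.left_dual_apply T.left_dual_closed That.add_ract DB.a_ac)
  have contract_balanced: "contract_B (\<alpha> r \<triangleright>\<^bsub>left_dual B T\<^esub> f) w = contract_B f (w \<triangleleft>\<^bsub>W\<^esub> \<alpha> r)"
    if "w \<in> carrier W" "f \<in> carrier (left_dual B T)" "r \<in> carrier R" for f r w
    using that
    by (induction w rule: TThT.M_NP_induct) (simp_all add: T.left_dual_apply)
  have "balanced R \<alpha> T (left_dual B T) DB (\<lambda>x f. contract_B f (\<gamma> x))"
    by (rule balancedI) (simp_all add: contract_add contract_balanced)
  note [simp] = TLD.lift_simps[OF DB.tensor_abelian this, folded g_def]
  have gh: "g (h d) = d" if "d \<in> carrier DB" for d
    using that by (induction d rule: DB.tensor_induct) simp_all
  \<comment> \<open>For x in \<open>T\<close>: evh(x \<otimes> v f(t)) = evh(x \<otimes> v) f(t) =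
    f(evh(x \<otimes> v) t) = f(x ev(v \<otimes> t)), by left linearity of \<open>f\<close> and
    \<open>evh_ev\<close>.\<close>
  have dual: "evh_map (v \<triangleleft>\<^bsub>That\<^esub> f t) = ev (pC v t) \<triangleright>\<^bsub>left_dual B T\<^esub> f"
    if "f \<in> carrier (left_dual B T)" "t \<in> carrier T" "v \<in> carrier That" for f t v
    using that
    by (auto simp: T.left_dual_ops T.left_dual_carrier evh_map_def simp flip: DB.ract_pure evh_ev
        intro!: restrict_ext)
  have contract_gamma: "h (contract_B f (\<gamma> x)) = ?p x f"
    if f: "f \<in> carrier (left_dual B T)" and x: "x \<in> carrier T" for f x
  proof -
    have "balanced R \<alpha> T (regular A) ?Z (\<lambda>x a. ?p x (a \<triangleright>\<^bsub>left_dual B T\<^esub> f))"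
      using f by (intro balancedI) (simp_all add: LD.add_lact LD.mult_lact TLD.pure_balanced)
    note [simp] = TA.lift_simps[OF TLD.tensor_abelian this]
    have "h (contract_B f w) = tensor_lift ?Z (\<lambda>x a. ?p x (a \<triangleright>\<^bsub>left_dual B T\<^esub> f)) (T_ev w)"
      if "w \<in> carrier W" for w
      using that f
      by (induction w rule: TThT.M_NP_induct) (simp_all add: dual T.left_dual_closed)
    from this[of "\<gamma> x"] show ?thesis
      using f x by simp
  qed
  have hg: "h (g z) = z" if "z \<in> carrier ?Z" for z
    using that by (induction z rule: TLD.tensor_induct) (simp_all add: contract_gamma)
  have "bij_betw h (carrier DB) (carrier ?Z)"
    by (rule bij_betwI[where g = g]) (auto simp: gh hg)
  moreover have "h (b \<triangleright>\<^bsub>DB\<^esub> d) = b \<triangleright>\<^bsub>?Z\<^esub> h d" if "d \<in> carrier DB" "b \<in> carrier B" for b d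
    using that by (induction d rule: DB.tensor_induct) simp_all
  moreover have "h (d \<triangleleft>\<^bsub>DB\<^esub> b) = h d \<triangleleft>\<^bsub>?Z\<^esub> b" if "d \<in> carrier DB" "b \<in> carrier B" for b d
    using that by (induction d rule: DB.tensor_induct) (simp_all add: evh_map_ract)
  moreover have "h \<in> add_hom DB ?Z"
    by (rule add_homI) simp_all
  ultimately show ?thesis
    unfolding bimod_isomorphic_def by (blast intro: bimod_homI)
qed

end

section \<open>The coring and comodule structures over A and B together\<close>

theorem corollary2p8:
  fixes R :: "('r, 'x) ring_scheme" and S :: "('s, 'y) ring_scheme"
    and A :: "('a, 'z) ring_scheme" and B :: "('b, 'w) ring_scheme"
    and \<alpha> :: "'r \<Rightarrow> 'a" and \<beta> :: "'s \<Rightarrow> 'b"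
    and T :: "('b, 'a, 't) bimod" and That :: "('a, 'b, 'u) bimod"
    and ev :: "('u, 't) tens \<Rightarrow> 'a" and evh :: "('t, 'u) tens \<Rightarrow> 'b"
    and \<gamma> :: "'t \<Rightarrow> ('t, ('u, 't) tens) tens"
  assumes "bimodule_herd R S A B \<alpha> \<beta> T That ev evh \<gamma>"
  shows "(let C = tensor S \<beta> That T; \<gamma>\<^sub>A = shepherd_A S A \<beta> T That \<gamma> in
      bimod_isomorphic A A C (tensor S \<beta> (right_dual A T) T) \<and>
      (\<exists>\<Delta>. coring A C \<Delta> ev \<and>
        (\<forall>u\<in>carrier That. \<forall>x\<in>carrier T.
          \<Delta> (pure_tensor S \<beta> That T u x) =
            tensor_assoc_inv S \<beta> A id That T C
              (pure_tensor S \<beta> That (tensor A id T C) u (\<gamma>\<^sub>A x))) \<and>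
        right_comodule A C \<Delta> ev T \<gamma>\<^sub>A)) \<and>
    (let D = tensor R \<alpha> T That; \<gamma>\<^sub>B = shepherd_B R S B \<alpha> \<beta> T That \<gamma> in
      bimod_isomorphic B B D (tensor R \<alpha> T (left_dual B T)) \<and>
      (\<exists>\<Delta>. coring B D \<Delta> evh \<and>
        (\<forall>x\<in>carrier T. \<forall>u\<in>carrier That.
          \<Delta> (pure_tensor R \<alpha> T That x u) =
            tensor_assoc B id R \<alpha> D T That
              (pure_tensor R \<alpha> (tensor B id D T) That (\<gamma>\<^sub>B x) u)) \<and>
        left_comodule B D \<Delta> evh T \<gamma>\<^sub>B))"
proof -
  interpret bimodule_herd R S A B \<alpha> \<beta> T That ev evh \<gamma> by fact
  show ?thesis
    unfolding Let_def gamma_A_def [symmetric] gamma_B_def [symmetric]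
    using isomorphic_A coring_A comodule_A Delta_A_pure isomorphic_B coring_B comodule_B Delta_B_pure
    by blast
qed

end
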